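(* A string with characters $(m,\ell)$ is closed (i.e. periodic) if and only if $\mathtt p(m,\ell)>0$ and $\Theta_2(m,\ell),\Theta_3(m,\ell)\in\mathbb Q$.
   Context: $\mathbb C^{2,1}$ is $\mathbb C^3$ with $\langle z,w\rangle=i(\bar z^1w^3-\bar z^3w^1)+\bar z^2w^2$; $\mathcal S=\{[z]\in\mathbb{CP}^2:\langle z,z\rangle=0\}$ with contact distribution $\ker\zeta$, $\zeta=-\frac{i}{\bar z^tz}\langle z,dz\rangle|_{T\mathcal S}$; Legendrian curves are immersions tangent to it. For a normalized lift $\Gamma$ ($\gamma=[\Gamma]$, $\det(\Gamma,\Gamma',\Gamma'')=i$) set $a=\mathrm{Im}\langle\Gamma''',\Gamma''\rangle$, $b=\frac12\langle\Gamma'',\Gamma''\rangle$. A generic Legendrian curve ($a$ never zero) is naturally parameterized if $a\equiv1$; then $\kappa=b$ is its cr-curvature. A string is a natural parameterization $\gamma:\mathbb R\to\mathcal S$ of a generic Legendrian curve with vanishing stress tensor (for $a\equiv1$ this is equivalent to $\kappa'''+8\kappa\kappa'=0$) whose cr-curvature is non-constant and periodic. Every such $\kappa$ equals $\kappa_{m,\ell}(u+u_0)$ for a unique $(m,\ell)\in(0,1)\times(0,\infty)$ (the characters) and some $u_0$, where $\kappa_{m,\ell}(u)=\frac32\ell^2\big(\frac{m+1}3-m\,\mathrm{sn}^2(\ell u,m)\big)$, $\mathrm{sn}(\cdot,m)$ being the Jacobi elliptic sine with parameter $m$ (square of the modulus). Set $\mathtt p(m,\ell)=64\big(m^2(m-1)^2\ell^{12}+2(m-2)(1+m)(2m-1)\ell^6-27\big)$.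 When $\mathtt p(m,\ell)>0$ put $\sigma=\sqrt{1-m+m^2}$, $\widetilde{\mathtt p}=\frac{(m-2)(1+m)(2m-1)\ell^6-27}{2\sigma^3\ell^6}\in(-1,1)$, $\alpha=\frac13\arcsin\widetilde{\mathtt p}$, and $\lambda_2=-\frac43\sigma\ell^2\sin\alpha$, $\lambda_3=\frac23\sigma\ell^2\sin\alpha+\frac2{\sqrt3}\sigma\ell^2\cos\alpha$, $\lambda_1=-\lambda_2-\lambda_3$, and for $j=2,3$ $$\Theta_j(m,\ell)=\frac{6\,\Pi\!\left(\frac{6m\ell^2}{2(1+m)\ell^2+3\lambda_j},m\right)}{\pi\ell\,(2(1+m)\ell^2+3\lambda_j)}=\frac3\pi\int_0^{2K(m)/\ell}\frac{du}{4\kappa_{m,\ell}(u)+3\lambda_j},$$ where $K(m)$ and $\Pi(n,m)=\int_0^{\pi/2}\frac{d\theta}{(1-n\sin^2\theta)\sqrt{1-m\sin^2\theta}}$ are the complete elliptic integrals of the first and third kind. *)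

theory Defs
  imports "HOL-Analysis.Analysis"
begin

definition herm :: "complex^3 \<Rightarrow> complex^3 \<Rightarrow> complex" where
  "herm z w = \<i> * (cnj (z$1) * w$3 - cnj (z$3) * w$1) + cnj (z$2) * w$2"

fun hderiv :: "nat \<Rightarrow> (real \<Rightarrow> 'a::real_normed_vector) \<Rightarrow> real \<Rightarrow> 'a" where
  "hderiv 0 f = f"
| "hderiv (Suc n) f = (\<lambda>t. vector_derivative (hderiv n f) (at t))"

definition smooth_curve :: "(real \<Rightarrow> 'a::real_normed_vector) \<Rightarrow> bool" where
  "smooth_curve f \<longleftrightarrow> (\<forall>n t. (hderiv n f has_vector_derivative hderiv (Suc n) f t) (at t))"

definition normalized_legendrian_lift :: "(real \<Rightarrow> complex^3) \<Rightarrow> bool" where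
  "normalized_legendrian_lift G \<longleftrightarrow> smooth_curve G \<and>
     (\<forall>u. G u \<noteq> 0 \<and> herm (G u) (G u) = 0 \<and> herm (G u) (hderiv 1 G u) = 0 \<and>
          det (vector [G u, hderiv 1 G u, hderiv 2 G u] :: complex^3^3) = \<i>)"

definition inv_a :: "(real \<Rightarrow> complex^3) \<Rightarrow> real \<Rightarrow> real" where
  "inv_a G u = Im (herm (hderiv 3 G u) (hderiv 2 G u))"

definition inv_b :: "(real \<Rightarrow> complex^3) \<Rightarrow> real \<Rightarrow> real" where
  "inv_b G u = Re (herm (hderiv 2 G u) (hderiv 2 G u)) / 2"

text \<open>A string, given via a normalized lift G (gamma = [G]) with a = 1; kappa = b.\<close>
definition is_string_lift :: "(real \<Rightarrow> complex^3) \<Rightarrow> bool" where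
  "is_string_lift G \<longleftrightarrow> normalized_legendrian_lift G \<and> (\<forall>u. inv_a G u = 1) \<and>
     (\<forall>u. hderiv 3 (inv_b G) u + 8 * inv_b G u * hderiv 1 (inv_b G) u = 0) \<and>
     (\<exists>u v. inv_b G u \<noteq> inv_b G v) \<and>
     (\<exists>T>0. \<forall>u. inv_b G (u + T) = inv_b G u)"

text \<open>The curve gamma = [G] in CP^2 is closed (periodic).\<close>
definition closed_curve :: "(real \<Rightarrow> complex^3) \<Rightarrow> bool" where
  "closed_curve G \<longleftrightarrow> (\<exists>T>0. \<forall>u. \<exists>c. c \<noteq> 0 \<and> G (u + T) = c *s G u)"

definition ellF :: "real \<Rightarrow> real \<Rightarrow> real" where
  "ellF phi m = (if 0 \<le> phi then integral {0..phi} (\<lambda>t. 1 / sqrt (1 - m * (sin t)^2))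
                 else - integral {phi..0} (\<lambda>t. 1 / sqrt (1 - m * (sin t)^2)))"

definition jacobi_am :: "real \<Rightarrow> real \<Rightarrow> real" where
  "jacobi_am x m = (THE phi. ellF phi m = x)"

definition jacobi_sn :: "real \<Rightarrow> real \<Rightarrow> real" where
  "jacobi_sn x m = sin (jacobi_am x m)"

definition ellK :: "real \<Rightarrow> real" where
  "ellK m = ellF (pi/2) m"

definition ellPi :: "real \<Rightarrow> real \<Rightarrow> real" where
  "ellPi n m = integral {0..pi/2} (\<lambda>t. 1 / ((1 - n * (sin t)^2) * sqrt (1 - m * (sin t)^2)))"

definition kappa_ml :: "real \<Rightarrow> real \<Rightarrow> real \<Rightarrow> real" where
  "kappa_ml m l u = 3/2 * l^2 * ((m + 1) / 3 - m * (jacobi_sn (l * u) m)^2)"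

definition pp :: "real \<Rightarrow> real \<Rightarrow> real" where
  "pp m l = 64 * (m^2 * (m - 1)^2 * l^12 + 2 * (m - 2) * (1 + m) * (2*m - 1) * l^6 - 27)"

definition sigma_m :: "real \<Rightarrow> real" where
  "sigma_m m = sqrt (1 - m + m^2)"

definition pt :: "real \<Rightarrow> real \<Rightarrow> real" where
  "pt m l = ((m - 2) * (1 + m) * (2*m - 1) * l^6 - 27) / (2 * sigma_m m ^ 3 * l^6)"

definition alpha_ml :: "real \<Rightarrow> real \<Rightarrow> real" where
  "alpha_ml m l = arcsin (pt m l) / 3"

definition lambda2 :: "real \<Rightarrow> real \<Rightarrow> real" where
  "lambda2 m l = - 4/3 * sigma_m m * l^2 * sin (alpha_ml m l)"

definition lambda3 :: "real \<Rightarrow> real \<Rightarrow> real" where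
  "lambda3 m l = 2/3 * sigma_m m * l^2 * sin (alpha_ml m l)
                 + 2 / sqrt 3 * sigma_m m * l^2 * cos (alpha_ml m l)"

definition Theta :: "real \<Rightarrow> real \<Rightarrow> real \<Rightarrow> real" where
  "Theta lam m l = 6 * ellPi (6 * m * l^2 / (2 * (1 + m) * l^2 + 3 * lam)) m
                   / (pi * l * (2 * (1 + m) * l^2 + 3 * lam))"

end

theory Submission
  imports Defs
begin

text \<open>
  The normalization forces the Gram matrix of $(\Gamma,\Gamma',\Gamma'')$ and hence
  $\Gamma''' = -2\kappa\Gamma' + (i-\kappa')\Gamma$.  Consequently the functions
  $\langle v,\Gamma\rangle$ with $v$ constant are exactly the solutions of
  $L g = i g$, where $L = \partial^3 + 2\kappa\partial + \kappa'$.  The equation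
  $\kappa'''+8\kappa\kappa'=0$ says that $L$ commutes with $P = \partial^2+\frac43\kappa$, so
  the monodromy can be read off the eigenfunctions of $P$: for $P g=\mu g$ one gets
  $g'/g = (3i+\kappa')/(3\mu+2\kappa)$, where $\mu$ runs through the roots of a cubic with
  discriminant proportional to $\mathtt p$ (and $\lambda=2\mu$).

  A real root yields the multiplier $e^{2\pi i\Theta}$ over one period of $\kappa$.  For a nonreal
  root the modulus of the multiplier differs from $1$, and for a double root the monodromy has a
  nontrivial Jordan block; in both cases the curve is not closed.  If the three roots are real and
  distinct, their $\Theta$'s sum to zero, since
  $\sum_j 3/(3\mu_j+2\kappa) = (\arctan(\kappa'/3))'$, so rationality of two of them suffices.
\<close>

section \<open>Primitives of periodic functions\<close>

text \<open>Signed below 0, so that it is an antiderivative on the whole line and matches the case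
  split in \<open>ellF\<close>.\<close>

definition primitive :: "(real \<Rightarrow> 'a::banach) \<Rightarrow> real \<Rightarrow> 'a" where
  "primitive f x = (if 0 \<le> x then integral {0..x} f else - integral {x..0} f)"

lemma primitive_has_vector_derivative:
  fixes f :: "real \<Rightarrow> 'a::banach"
  assumes f: "continuous_on UNIV f"
  shows "(primitive f has_vector_derivative f x) (at x)"
proof -
  define a b where "a = - \<bar>x\<bar> - 1" and "b = \<bar>x\<bar> + 1"
  have x: "x \<in> {a<..<b}" "a < 0" "0 < b"
    by (auto simp: a_def b_def)
  have int: "f integrable_on {c..d}" for c d
    using f by (intro integrable_continuous_interval) (auto intro: continuous_on_subset)
  have eq: "integral {a..y} f - integral {a..0} f = primitive f y" if "y \<in> {a<..<b}" for y
  proof (cases "0 \<le> y")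
    case True
    have "integral {a..0} f + integral {0..y} f = integral {a..y} f"
      using x True int by (intro Henstock_Kurzweil_Integration.integral_combine) auto
    then show ?thesis using True by (simp add: primitive_def algebra_simps)
  next
    case False
    have "integral {a..y} f + integral {y..0} f = integral {a..0} f"
      using x False int that by (intro Henstock_Kurzweil_Integration.integral_combine) auto
    then show ?thesis using False by (simp add: primitive_def algebra_simps)
  qed
  have "((\<lambda>y. integral {a..y} f) has_vector_derivative f x) (at x within {a..b})"
    using f x by (intro integral_has_vector_derivative) (auto intro: continuous_on_subset)
  then have "((\<lambda>y. integral {a..y} f) has_vector_derivative f x) (at x)"
    using x by (simp add: at_within_Icc_at)
  then have "((\<lambda>y. integral {a..y} f - integral {a..0} f) has_vector_derivative f x) (at x)"
    by (auto intro!: derivative_eq_intros)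
  then show ?thesis
    by (rule has_vector_derivative_transform_within_open[where S = "{a<..<b}"])
       (use x eq in auto)
qed

lemma primitive_0 [simp]: "primitive f 0 = 0"
  by (simp add: primitive_def)

lemma zero_vector_derivative_imp_eq:
  fixes f :: "real \<Rightarrow> 'a::real_normed_vector"
  assumes "\<And>x. (f has_vector_derivative 0) (at x)"
  shows "f x = f y"
  by (metis UNIV_I assms convex_UNIV has_vector_derivative_zero_constant)

lemma primitive_add_period:
  fixes f :: "real \<Rightarrow> 'a::banach"
  assumes f: "continuous_on UNIV f" and per: "\<And>x. f (x + p) = f x"
  shows "primitive f (x + p) = primitive f x + primitive f p"
proof -
  have shift: "((\<lambda>x. primitive f (x + p)) has_vector_derivative f x) (at x)" for x
  proof -
    have *: "((\<lambda>x. x + p) has_vector_derivative 1) (at x)"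
      by (auto intro!: derivative_eq_intros)
    show ?thesis
      using vector_diff_chain_at[OF * primitive_has_vector_derivative[OF f, of "x + p"]]
      by (simp add: o_def per)
  qed
  have "((\<lambda>x. primitive f (x + p) - primitive f x) has_vector_derivative 0) (at x)" for x
    using has_vector_derivative_diff[OF shift primitive_has_vector_derivative[OF f]] by simp
  from zero_vector_derivative_imp_eq[OF this, of x 0] show ?thesis
    by (simp add: algebra_simps)
qed

lemma primitive_minus:
  fixes f :: "real \<Rightarrow> 'a::banach"
  assumes f: "continuous_on UNIV f" and even: "\<And>x. f (- x) = f x"
  shows "primitive f (- x) = - primitive f x"
proof -
  have refl: "((\<lambda>x. primitive f (- x)) has_vector_derivative - f x) (at x)" for x
  proof -
    have *: "((\<lambda>x. - x :: real) has_vector_derivative - 1) (at x)"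
      by (auto intro!: derivative_eq_intros)
    show ?thesis
      using vector_diff_chain_at[OF * primitive_has_vector_derivative[OF f, of "- x"]]
      by (simp add: o_def even)
  qed
  have "((\<lambda>x. primitive f (- x) + primitive f x) has_vector_derivative 0) (at x)" for x
    using has_vector_derivative_add[OF refl primitive_has_vector_derivative[OF f]] by simp
  from zero_vector_derivative_imp_eq[OF this, of x 0] show ?thesis
    by (simp add: algebra_simps eq_neg_iff_add_eq_0)
qed

text \<open>Shifting from \<open>- (p/2)\<close> to \<open>p/2\<close> and using oddness of the
  primitive halves the interval. This is how complete integrals up to pi/2 become increments over
  the period pi.\<close>

lemma primitive_even_add_period:
  fixes f :: "real \<Rightarrow> real"
  assumes f: "continuous_on UNIV f" and even: "\<And>x. f (- x) = f x" and per: "\<And>x. f (x + p) = f x"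
  shows "primitive f (x + p) = primitive f x + 2 * primitive f (p/2)"
proof -
  have "primitive f (p/2) = - primitive f (p/2) + primitive f p"
    using primitive_add_period[OF f per, of "- (p/2)"] primitive_minus[OF f even, of "p/2"]
    by simp
  then show ?thesis
    using primitive_add_period[OF f per, of x] by simp
qed

section \<open>Auxiliary identities\<close>

lemma cos_squared: "(cos (t::real))\<^sup>2 = 1 - (sin t)\<^sup>2"
  using sin_cos_squared_add[of t] by linarith

lemma sin_triple: "sin (3 * x) = 3 * sin x - 4 * (sin x)^3" for x :: real
proof -
  have "sin (x + 2 * x) = sin x * (1 - 2 * (sin x)\<^sup>2) + 2 * sin x * (cos x)\<^sup>2"
    by (simp only: sin_add sin_double cos_double_sin) (simp add: power2_eq_square)
  then show ?thesis
    unfolding cos_squared by (simp add: power2_eq_square power3_eq_cube algebra_simps)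
qed

text \<open>Divided differences eliminate the coefficients one at a time. It later shows that
  eigenvectors for three distinct roots have no common orthogonal vector except 0.\<close>

lemma quadratic_three_zeros:
  fixes p q r :: "'a::field"
  assumes "p * x\<^sup>2 + q * x + r = 0" "p * y\<^sup>2 + q * y + r = 0" "p * z\<^sup>2 + q * z + r = 0"
    and "x \<noteq> y" "x \<noteq> z" "y \<noteq> z"
  shows "p = 0" "q = 0" "r = 0"
proof -
  have "(x - y) * (p * (x + y) + q) = 0" "(x - z) * (p * (x + z) + q) = 0"
    using assms(1-3) by algebra+
  then have *: "p * (x + y) + q = 0" "p * (x + z) + q = 0"
    using assms by auto
  then have "(y - z) * p = 0" by algebra
  then show "p = 0" using assms by simp
  with * assms(1) show "q = 0" "r = 0" by auto
qed

lemma has_vector_derivative_inverse_complex: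
  fixes f :: "real \<Rightarrow> complex"
  assumes "(f has_vector_derivative f') (at u)" "f u \<noteq> 0"
  shows "((\<lambda>u. inverse (f u)) has_vector_derivative - f' / (f u)\<^sup>2) (at u)"
proof -
  have "(inverse has_field_derivative - inverse ((f u)\<^sup>2)) (at (f u))"
    using DERIV_inverse[OF assms(2)] by (simp add: numeral_2_eq_2)
  from field_vector_diff_chain_at[OF assms(1) this] show ?thesis
    by (simp add: o_def divide_inverse)
qed

section \<open>The Jacobi amplitude\<close>

locale elliptic =
  fixes m :: real
  assumes m_pos: "0 < m" and m_less_1: "m < 1"
begin

lemma sin_squared_less: "m * (sin t)\<^sup>2 < 1"
proof -
  have "m * (sin t)\<^sup>2 \<le> m"
    using m_pos by (intro mult_left_le) (auto simp: abs_square_le_1)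
  then show ?thesis using m_less_1 by linarith
qed

definition Delta :: "real \<Rightarrow> real" where
  "Delta t = sqrt (1 - m * (sin t)\<^sup>2)"

lemma Delta_pos: "0 < Delta t"
  using sin_squared_less by (simp add: Delta_def)

lemma Delta_le_1: "Delta t \<le> 1"
  using m_pos by (simp add: Delta_def)

lemma Delta_squared: "(Delta t)\<^sup>2 = 1 - m * (sin t)\<^sup>2"
  using sin_squared_less[of t] by (simp add: Delta_def)

lemma continuous_Delta [continuous_intros]: "continuous_on S Delta"
  unfolding Delta_def by (intro continuous_intros)

lemma Delta_minus [simp]: "Delta (- t) = Delta t"
  by (simp add: Delta_def)

lemma Delta_add_pi [simp]: "Delta (t + pi) = Delta t"
  by (simp add: Delta_def)

lemma continuous_inverse_Delta: "continuous_on UNIV (\<lambda>t. 1 / Delta t)"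
  using Delta_pos by (intro continuous_intros) (metis less_irrefl)

lemma ellF_eq: "ellF x m = primitive (\<lambda>t. 1 / Delta t) x"
  by (simp add: ellF_def primitive_def Delta_def)

lemma ellF_deriv: "((\<lambda>x. ellF x m) has_real_derivative 1 / Delta x) (at x)"
  unfolding ellF_eq has_real_derivative_iff_has_vector_derivative
  by (rule primitive_has_vector_derivative[OF continuous_inverse_Delta])

text \<open>The integrand \<open>1 / Delta\<close> is at least 1. This one estimate yields
  injectivity and surjectivity of \<open>ellF\<close> and makes its inverse 1-Lipschitz.\<close>

lemma ellF_growth:
  assumes "x \<le> y" shows "y - x \<le> ellF y m - ellF x m"
proof -
  have "(\<lambda>x. ellF x m - x) x \<le> (\<lambda>x. ellF x m - x) y"
  proof (rule DERIV_nonneg_imp_nondecreasing[OF assms])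
    fix t
    have "((\<lambda>x. ellF x m - x) has_real_derivative 1 / Delta t - 1) (at t)"
      by (auto intro!: derivative_eq_intros ellF_deriv)
    moreover have "0 \<le> 1 / Delta t - 1"
      using Delta_pos[of t] Delta_le_1[of t] by simp
    ultimately show "\<exists>d. ((\<lambda>x. ellF x m - x) has_real_derivative d) (at t) \<and> 0 \<le> d"
      by blast
  qed
  then show ?thesis by simp
qed

lemma ellF_0 [simp]: "ellF 0 m = 0"
  by (simp add: ellF_eq)

lemma ellF_inj: "ellF x m = ellF y m \<Longrightarrow> x = y"
  using ellF_growth[of x y] ellF_growth[of y x] by linarith

lemma ellF_surj: "\<exists>y. ellF y m = x"
proof -
  have "isCont (\<lambda>y. ellF y m) y" for y
    using ellF_deriv DERIV_isCont by blast
  moreover have "ellF (- \<bar>x\<bar>) m \<le> x" "x \<le> ellF \<bar>x\<bar> m"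
    using ellF_growth[of "- \<bar>x\<bar>" 0] ellF_growth[of 0 "\<bar>x\<bar>"] by auto
  ultimately show ?thesis
    using IVT[of "\<lambda>y. ellF y m" "- \<bar>x\<bar>" x "\<bar>x\<bar>"] by auto
qed

abbreviation am :: "real \<Rightarrow> real" where "am x \<equiv> jacobi_am x m"

text \<open>Existence and uniqueness of the preimage justify the definite description in
  \<open>jacobi_am\<close>.\<close>

lemma ellF_am: "ellF (am x) m = x"
proof -
  have "\<exists>!y. ellF y m = x"
    using ellF_surj ellF_inj by metis
  then show ?thesis
    unfolding jacobi_am_def by (rule theI')
qed

lemma am_ellF: "am (ellF y m) = y"
  by (rule ellF_inj) (rule ellF_am)

lemma continuous_am: "isCont am x"
proof -
  have "\<bar>am y - am x\<bar> \<le> \<bar>y - x\<bar>" for y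
    using ellF_growth[of "am x" "am y"] ellF_growth[of "am y" "am x"] ellF_am[of x] ellF_am[of y]
    by linarith
  then show ?thesis
    unfolding continuous_at_eps_delta dist_real_def by (meson le_less_trans)
qed

lemma am_deriv: "(am has_real_derivative Delta (am x)) (at x)"
proof -
  have "(am has_real_derivative inverse (1 / Delta (am x))) (at x)"
    by (rule DERIV_inverse_function[where f = "\<lambda>y. ellF y m" and a = "x - 1" and b = "x + 1"])
       (use Delta_pos[of "am x"] in \<open>auto simp: ellF_deriv ellF_am continuous_am\<close>)
  then show ?thesis by simp
qed

lemma ellF_add_pi: "ellF (y + pi) m = ellF y m + 2 * ellK m"
  unfolding ellF_eq ellK_def
  using primitive_even_add_period[OF continuous_inverse_Delta, of pi] by simp

lemma am_add_period: "am (x + 2 * ellK m) = am x + pi"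
  by (metis am_ellF ellF_add_pi ellF_am)

text \<open>Places the zeros of sn, where the amplitude is a multiple of pi, at the multiples of
  \<open>2 * ellK m\<close>.\<close>

lemma ellF_int_pi: "ellF (of_int n * pi) m = 2 * of_int n * ellK m"
proof -
  have nat: "ellF (y + real n * pi) m = ellF y m + 2 * real n * ellK m" for y n
  proof (induction n)
    case (Suc n)
    then show ?case using ellF_add_pi[of "y + real n * pi"] by (simp add: algebra_simps)
  qed simp
  show ?thesis
  proof (cases "0 \<le> n")
    case True
    then show ?thesis using nat[of 0 "Int.nat n"] by simp
  next
    case False
    then show ?thesis using nat[of "of_int n * pi" "Int.nat (- n)"] by simp
  qed
qed

lemma ellK_pos: "0 < ellK m"
  using ellF_growth[of 0 "pi/2"] pi_gt_zero unfolding ellK_def ellF_0 by linarith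

end

section \<open>The curvature and its spectral cubic\<close>

locale string_curvature = elliptic +
  fixes l u0 :: real
  assumes l_pos: "0 < l"
begin

definition phi :: "real \<Rightarrow> real" where
  "phi u = am (l * (u + u0))"

definition k :: "real \<Rightarrow> real" where
  "k u = kappa_ml m l (u + u0)"

text \<open>The function kappa' in the closed form -3 m l^3 sn cn dn.\<close>

definition k1 :: "real \<Rightarrow> real" where
  "k1 u = - 3 * m * l^3 * sin (phi u) * cos (phi u) * Delta (phi u)"

text \<open>Half the period of sn: kappa contains only its square, so raising the amplitude by pi
  suffices.\<close>

definition period :: real where
  "period = 2 * ellK m / l"

text \<open>The first integrals $C_1 = \kappa'' + 4\kappa^2$ and
  $C_2 = \frac12\kappa'^2 + \frac43\kappa^3 - C_1\kappa$, evaluated where $\mathrm{sn} = 0$.\<close>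

definition C1 :: real where
  "C1 = l^4 * (1 - m + m\<^sup>2)"

definition C2 :: real where
  "C2 = - (l^6 * ((m - 2) * (1 + m) * (2*m - 1)) / 6)"

lemma k_eq: "k u = 3/2 * l\<^sup>2 * ((m + 1) / 3 - m * (sin (phi u))\<^sup>2)"
  by (simp add: k_def kappa_ml_def jacobi_sn_def phi_def)

lemma phi_deriv [derivative_intros]: "(phi has_real_derivative l * Delta (phi u)) (at u)"
proof -
  have "((\<lambda>u. l * (u + u0)) has_real_derivative l) (at u)"
    by (auto intro!: derivative_eq_intros)
  from DERIV_chain2[OF am_deriv this] show ?thesis
    unfolding phi_def by (simp add: mult.commute)
qed

lemma Delta_deriv:
  "(Delta has_real_derivative - m * sin t * cos t / Delta t) (at t)"
proof -
  have "((\<lambda>t. sqrt (1 - m * (sin t)\<^sup>2)) has_real_derivative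
          (- m * (2 * sin t * cos t)) * (inverse (sqrt (1 - m * (sin t)\<^sup>2)) / 2)) (at t)"
    using sin_squared_less[of t]
    by (auto intro!: derivative_eq_intros simp: field_simps)
  then show ?thesis
    unfolding Delta_def[abs_def] by (simp add: field_simps)
qed

lemma k_deriv: "(k has_real_derivative k1 u) (at u)"
  unfolding k_eq[abs_def] k1_def
  by (auto intro!: derivative_eq_intros simp: power2_eq_square power3_eq_cube)

text \<open>This and \<open>k1_squared\<close> become polynomial identities in the squared sine once
  the squares of cos and \<open>Delta\<close> are eliminated.\<close>

lemma k1_deriv: "(k1 has_real_derivative C1 - 4 * (k u)\<^sup>2) (at u)"
proof -
  let ?S = "sin (phi u)" and ?C = "cos (phi u)" and ?D = "Delta (phi u)"
  have D: "((\<lambda>u. Delta (phi u)) has_real_derivative - m * ?S * ?C * l) (at u)"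
    using DERIV_chain2[OF Delta_deriv phi_deriv, of u] Delta_pos[of "phi u"]
    by (simp add: mult.commute mult.left_commute)
  have "(k1 has_real_derivative
      - 3 * m * l^3 * (?C^2 * l * ?D^2 - ?S^2 * l * ?D^2 - m * l * (?S^2 * ?C^2))) (at u)"
    unfolding k1_def[abs_def]
    by (auto intro!: derivative_eq_intros D simp: power2_eq_square algebra_simps)
  also have "- 3 * m * l^3 * (?C^2 * l * ?D^2 - ?S^2 * l * ?D^2 - m * l * (?S^2 * ?C^2))
    = C1 - 4 * (k u)\<^sup>2"
    unfolding cos_squared Delta_squared k_eq C1_def by algebra
  finally show ?thesis .
qed

lemma k1_squared: "(k1 u)\<^sup>2 = 2 * C1 * k u + 2 * C2 - 8/3 * (k u)^3"
proof -
  let ?S = "sin (phi u)" and ?C = "cos (phi u)" and ?D = "Delta (phi u)"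
  have "(k1 u)\<^sup>2 = 9 * m^2 * l^6 * ?S^2 * ?C^2 * ?D^2"
    by (simp add: k1_def power_mult_distrib flip: power_mult)
  also have "\<dots> = 2 * C1 * k u + 2 * C2 - 8/3 * (k u)^3"
    unfolding cos_squared Delta_squared k_eq C1_def C2_def
    by (simp add: field_simps) algebra
  finally show ?thesis .
qed

lemma period_pos: "0 < period"
  using ellK_pos l_pos by (simp add: period_def)

lemma phi_add_period: "phi (u + period) = phi u + pi"
proof -
  have "l * (u + period + u0) = l * (u + u0) + 2 * ellK m"
    using l_pos by (simp add: period_def field_simps)
  then show ?thesis
    by (simp add: phi_def am_add_period)
qed

lemma k_add_period [simp]: "k (u + period) = k u"
  by (simp add: k_eq phi_add_period)

lemma k1_add_period [simp]: "k1 (u + period) = k1 u"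
  by (simp add: k1_def phi_add_period)

lemma phi_surj: "\<exists>u. phi u = t"
  by (rule exI[of _ "ellF t m / l - u0"]) (use l_pos in \<open>simp add: phi_def am_ellF\<close>)

text \<open>At \<open>- u0\<close> sn vanishes and kappa is maximal, so kappa regains that value
  only at zeros of sn.\<close>

lemma k_period_imp_multiple:
  assumes "\<And>u. k (u + T) = k u"
  shows "\<exists>n::int. T = of_int n * period"
proof -
  have "k (- u0 + T) = k (- u0)"
    by (rule assms)
  moreover have "am 0 = 0"
    using am_ellF[of 0] by simp
  ultimately have "sin (am (l * T)) = 0"
    using l_pos m_pos by (simp add: k_eq phi_def field_simps)
  then obtain n :: int where n: "am (l * T) = of_int n * pi"
    using sin_zero_iff_int2 by blast
  have "l * T = 2 * of_int n * ellK m"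
    using ellF_am[of "l * T"] ellF_int_pi[of n] n by simp
  then have "T = of_int n * period"
    using l_pos by (simp add: period_def field_simps)
  then show ?thesis ..
qed

text \<open>The characteristic polynomial of $\partial^2 + \frac43\kappa$ on the solution space of
  $g''' + 2\kappa g' + \kappa' g = i g$, up to a constant factor.\<close>

definition charpoly :: "complex \<Rightarrow> complex" where
  "charpoly \<mu> = 9 * \<mu>^3 - 3 * of_real C1 * \<mu> + 2 * of_real C2 + 9"

definition den :: "complex \<Rightarrow> real \<Rightarrow> complex" where
  "den \<mu> u = 3 * \<mu> + 2 * of_real (k u)"

lemma k1_squared_complex:
  "(complex_of_real (k1 u))\<^sup>2 = 2 * of_real C1 * of_real (k u) + 2 * of_real C2 - 8/3 * (of_real (k u))^3"
  using arg_cong[OF k1_squared[of u], of complex_of_real] by simp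

text \<open>The Riccati equation of \<open>log_deriv\<close> with denominators cleared. After
  substitution of the first integrals the two sides differ, up to sign, by
  \<open>charpoly \<mu>\<close>.\<close>

lemma charpoly_root:
  assumes "charpoly \<mu> = 0"
  shows "(of_real C1 - 4 * (of_real (k u))\<^sup>2) * den \<mu> u - (of_real (k1 u))\<^sup>2 - 9
    = (\<mu> - 4/3 * of_real (k u)) * (den \<mu> u)\<^sup>2"
  using assms unfolding charpoly_def den_def k1_squared_complex
  by (simp add: field_simps) algebra

text \<open>A zero of \<open>den\<close> would turn \<open>charpoly_root\<close> into kappa'^2 = -9,
  impossible for real kappa'.\<close>

lemma den_nonzero:
  assumes "charpoly \<mu> = 0"
  shows "den \<mu> u \<noteq> 0"
proof
  assume "den \<mu> u = 0"
  with charpoly_root[OF assms, of u] have "complex_of_real ((k1 u)\<^sup>2 + 9) = 0"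
    by (simp add: algebra_simps neg_eq_iff_add_eq_0)
  then have "(k1 u)\<^sup>2 + 9 = 0"
    using of_real_eq_0_iff by blast
  then show False
    using zero_le_power2[of "k1 u"] by linarith
qed

definition log_deriv :: "complex \<Rightarrow> real \<Rightarrow> complex" where
  "log_deriv \<mu> u = (3 * \<i> + of_real (k1 u)) / den \<mu> u"

lemma k_vderiv [derivative_intros]:
  "((\<lambda>u. complex_of_real (k u)) has_vector_derivative of_real (k1 u)) (at u)"
  using has_vector_derivative_of_real[of k "k1 u"] k_deriv[of u]
  by (simp add: has_real_derivative_iff_has_vector_derivative)

lemma k1_vderiv [derivative_intros]:
  "((\<lambda>u. complex_of_real (k1 u)) has_vector_derivative of_real C1 - 4 * (of_real (k u))\<^sup>2) (at u)"
  using has_vector_derivative_of_real[of k1 "C1 - 4 * (k u)\<^sup>2"] k1_deriv[of u]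
  by (simp add: has_real_derivative_iff_has_vector_derivative)

lemma den_vderiv: "(den \<mu> has_vector_derivative 2 * of_real (k1 u)) (at u)"
  unfolding den_def[abs_def] by (auto intro!: derivative_eq_intros)

text \<open>The Riccati form of g'' + (4/3) kappa g = mu g, where g'/g =
  \<open>log_deriv \<mu>\<close>.\<close>

lemma log_deriv_vderiv:
  assumes root: "charpoly \<mu> = 0"
  shows "(log_deriv \<mu> has_vector_derivative (\<mu> - 4/3 * of_real (k u)) - (log_deriv \<mu> u)\<^sup>2) (at u)"
proof -
  note nz = den_nonzero[OF root, of u]
  have "((\<lambda>u. (3 * \<i> + of_real (k1 u)) * inverse (den \<mu> u)) has_vector_derivative
     (3 * \<i> + of_real (k1 u)) * (- (2 * of_real (k1 u)) / (den \<mu> u)\<^sup>2)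
       + (of_real C1 - 4 * (of_real (k u))\<^sup>2) * inverse (den \<mu> u)) (at u)"
    by (auto intro!: derivative_eq_intros
        has_vector_derivative_inverse_complex[OF den_vderiv nz])
  also have "(3 * \<i> + of_real (k1 u)) * (- (2 * of_real (k1 u)) / (den \<mu> u)\<^sup>2)
       + (of_real C1 - 4 * (of_real (k u))\<^sup>2) * inverse (den \<mu> u)
     = ((of_real C1 - 4 * (of_real (k u))\<^sup>2) * den \<mu> u - (of_real (k1 u))\<^sup>2 - 9)
         / (den \<mu> u)\<^sup>2 - (log_deriv \<mu> u)\<^sup>2"
    using nz unfolding log_deriv_def
    by (simp add: divide_simps power2_eq_square) (simp add: algebra_simps)
  also have "\<dots> = (\<mu> - 4/3 * of_real (k u)) - (log_deriv \<mu> u)\<^sup>2"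
    unfolding charpoly_root[OF root] using nz by simp
  finally show ?thesis
    unfolding log_deriv_def[abs_def] divide_inverse .
qed

end

section \<open>The frame of a normalized Legendrian lift\<close>

lemma herm_add_left: "herm (x + y) z = herm x z + herm y z"
  and herm_add_right: "herm z (x + y) = herm z x + herm z y"
  and herm_diff_left: "herm (x - y) z = herm x z - herm y z"
  and herm_diff_right: "herm z (x - y) = herm z x - herm z y"
  and herm_scale_left: "herm (c *s x) z = cnj c * herm x z"
  and herm_scale_right: "herm z (c *s x) = c * herm z x"
  and herm_minus_left: "herm (- x) z = - herm x z"
  and herm_minus_right: "herm z (- x) = - herm z x"
  by (simp_all add: herm_def algebra_simps)

lemmas herm_simps = herm_minus_left herm_minus_right
  herm_add_left herm_add_right herm_diff_left herm_diff_right
  herm_scale_left herm_scale_right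

lemma cnj_herm: "cnj (herm x y) = herm y x"
  by (simp add: herm_def algebra_simps)

lemma has_vector_derivative_vec_nth [derivative_intros]:
  "(f has_vector_derivative f') F \<Longrightarrow> ((\<lambda>t. f t $ i) has_vector_derivative f' $ i) F"
  by (rule bounded_linear.has_vector_derivative[OF bounded_linear_vec_nth])

lemma has_vector_derivative_herm:
  assumes "(f has_vector_derivative f') (at t)" "(g has_vector_derivative g') (at t)"
  shows "((\<lambda>t. herm (f t) (g t)) has_vector_derivative herm f' (g t) + herm (f t) g') (at t)"
  unfolding herm_def
  by (auto intro!: derivative_eq_intros assms simp: algebra_simps)

lemma vector_derivative_of_constant:
  assumes "(f has_vector_derivative f') (at (t::real))" "\<And>t. f t = c"
  shows "f' = 0"
proof -
  have "f = (\<lambda>t. c)" using assms(2) by auto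
  then show ?thesis
    using assms(1) vector_derivative_unique_at has_vector_derivative_const by blast
qed

text \<open>The Gram matrix factors as the conjugate of X, the matrix \<open>J\<close> of the form,
  and the transpose of Y; \<open>J\<close> has determinant -1.\<close>

lemma det_herm:
  fixes X Y :: "complex^3^3"
  shows "det (\<chi> i j. herm (X $ i) (Y $ j)) = - cnj (det X) * det Y"
proof -
  define J :: "complex^3^3" where
    "J = vector [vector [0, 0, \<i>], vector [0, 1, 0], vector [- \<i>, 0, 0]]"
  have "(\<chi> i j. herm (X $ i) (Y $ j)) = (\<chi> i j. cnj (X $ i $ j)) ** J ** transpose Y"
    by (simp add: vec_eq_iff matrix_matrix_mult_def sum_3 J_def transpose_def herm_def algebra_simps)
  moreover have "det J = - 1"
    by (simp add: J_def det_3)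
  moreover have "det (\<chi> i j. cnj (X $ i $ j)) = cnj (det X)"
    by (simp add: det_3)
  ultimately show ?thesis
    by (simp add: det_mul)
qed

lemma det_herm_vectors:
  "herm x1 y1 * herm x2 y2 * herm x3 y3 + herm x1 y2 * herm x2 y3 * herm x3 y1
   + herm x1 y3 * herm x2 y1 * herm x3 y2 - herm x1 y1 * herm x2 y3 * herm x3 y2
   - herm x1 y2 * herm x2 y1 * herm x3 y3 - herm x1 y3 * herm x2 y2 * herm x3 y1
   = - cnj (det (vector [x1, x2, x3])) * det (vector [y1, y2, y3])"
  using det_herm[of "vector [x1, x2, x3]" "vector [y1, y2, y3]"]
  by (simp add: det_3[of "\<chi> i j. herm (vector [x1, x2, x3] $ i) (vector [y1, y2, y3] $ j)"])

lemma herm_orthogonal_frame_imp_zero: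
  assumes det: "det (vector [x1, x2, x3] :: complex^3^3) \<noteq> 0"
    and "herm x1 y = 0" "herm x2 y = 0" "herm x3 y = 0"
  shows "y = 0"
proof -
  let ?A = "vector [x1, x2, x3] :: complex^3^3"
  \<comment> \<open>\<open>z\<close> absorbs the matrix of the form and a conjugation, so that
    orthogonality becomes an ordinary linear system with invertible matrix.\<close>
  define z :: "complex^3" where "z = vector [cnj (\<i> * y $ 3), cnj (y $ 2), cnj (- \<i> * y $ 1)]"
  have row: "(\<Sum>j\<in>UNIV. x $ j * z $ j) = cnj (herm x y)" for x
    by (simp add: sum_3 z_def herm_def algebra_simps)
  have "(?A *v z) $ i = 0" for i
    using exhaust_3[of i] assms by (auto simp: matrix_vector_mult_def row)
  then have "?A *v z = 0"
    by (simp add: vec_eq_iff)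
  moreover have "invertible ?A"
    using det by (simp add: invertible_det_nz)
  ultimately have "z = 0"
    by (metis invertible_def matrix_left_invertible_ker)
  then show ?thesis
    by (simp add: z_def vec_eq_iff forall_3)
qed

section \<open>The moving frame, its Gram matrix and the structure equation\<close>

locale legendrian_frame =
  fixes G :: "real \<Rightarrow> complex^3"
  assumes lift: "normalized_legendrian_lift G"
    and inv_a_eq_1: "inv_a G u = 1"
begin

definition "G1 = hderiv 1 G"
definition "G2 = hderiv 2 G"
definition "G3 = hderiv 3 G"

lemma frame_deriv:
  "(G has_vector_derivative G1 u) (at u)"
  "(G1 has_vector_derivative G2 u) (at u)"
  "(G2 has_vector_derivative G3 u) (at u)"
proof -
  have *: "(hderiv n G has_vector_derivative hderiv (Suc n) G u) (at u)" for n
    using lift by (auto simp: normalized_legendrian_lift_def smooth_curve_def)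
  show "(G has_vector_derivative G1 u) (at u)" "(G1 has_vector_derivative G2 u) (at u)"
    "(G2 has_vector_derivative G3 u) (at u)"
    using *[of 0] *[of 1] *[of 2]
    by (simp_all only: G1_def G2_def G3_def hderiv.simps(1) One_nat_def numeral_2_eq_2 numeral_3_eq_3)
qed

lemma det_frame: "det (vector [G u, G1 u, G2 u]) = \<i>"
  and herm_00: "herm (G u) (G u) = 0"
  and herm_01: "herm (G u) (G1 u) = 0"
  using lift by (auto simp: normalized_legendrian_lift_def G1_def G2_def)

lemma herm_10: "herm (G1 u) (G u) = 0"
  using herm_01[of u] cnj_herm by (metis complex_cnj_zero)

lemma herm_11_02: "herm (G1 u) (G1 u) + herm (G u) (G2 u) = 0"
  by (rule vector_derivative_of_constant[OF has_vector_derivative_herm[OF frame_deriv(1,2)]])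
     (rule herm_01)

text \<open>The Gram determinant of the frame collapses to -q^3 and equals -1 because the frame has
  determinant i. As q is real, the cube root is unique.\<close>

lemma herm_11: "herm (G1 u) (G1 u) = 1"
proof -
  define q where "q = Re (herm (G1 u) (G1 u))"
  have q: "herm (G1 u) (G1 u) = of_real q"
    using cnj_herm[of "G1 u" "G1 u"] by (simp add: q_def complex_eq_iff)
  have p: "herm (G u) (G2 u) = - of_real q"
    using herm_11_02[of u] by (simp add: q add_eq_0_iff)
  have p': "herm (G2 u) (G u) = - of_real q"
    using cnj_herm[of "G u" "G2 u"] p by simp
  have "complex_of_real (q^3) = of_real 1"
    using det_herm_vectors[of "G u" "G u" "G1 u" "G1 u" "G2 u" "G2 u"]
    by (simp add: q p p' det_frame herm_00 herm_01 herm_10 power3_eq_cube)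
  then have "q^3 = 1"
    using of_real_eq_iff by blast
  then have "q = 1"
    by (metis odd_numeral odd_real_root_power_cancel real_root_one zero_less_numeral)
  then show ?thesis by (simp add: q)
qed

lemma herm_02: "herm (G u) (G2 u) = - 1"
  using herm_11_02[of u] herm_11[of u] by (simp add: add_eq_0_iff)

lemma herm_20: "herm (G2 u) (G u) = - 1"
  using herm_02[of u] cnj_herm[of "G u" "G2 u"] by simp

text \<open>Differentiating the constant determinant leaves only the term with the third derivative;
  the others have a repeated row.\<close>

lemma det_frame_deriv: "det (vector [G u, G1 u, G3 u]) = 0"
proof -
  have "((\<lambda>u. det (vector [G u, G1 u, G2 u])) has_vector_derivative
      det (vector [G u, G1 u, G3 u])) (at u)"
    unfolding det_3 vector_3
    by (auto intro!: derivative_eq_intros frame_deriv simp: algebra_simps)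
  then show ?thesis
    by (rule vector_derivative_of_constant) (rule det_frame)
qed

text \<open>The mixed Gram determinant against (G, G1, G3) reduces to this single product and
  vanishes by \<open>det_frame_deriv\<close>.\<close>

lemma herm_03: "herm (G u) (G3 u) = 0"
  using det_herm_vectors[of "G u" "G u" "G1 u" "G1 u" "G2 u" "G3 u"]
  by (simp add: det_frame_deriv herm_00 herm_01 herm_10 herm_11 herm_20)

lemma herm_12: "herm (G1 u) (G2 u) = 0"
  using vector_derivative_of_constant[OF has_vector_derivative_herm[OF frame_deriv(1,3)] herm_02]
    herm_03 by simp

lemma herm_21: "herm (G2 u) (G1 u) = 0"
  using herm_12[of u] cnj_herm[of "G1 u" "G2 u"] by simp

lemma herm_22: "herm (G2 u) (G2 u) = of_real (2 * inv_b G u)"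
  using cnj_herm[of "G2 u" "G2 u"] by (simp add: inv_b_def G2_def complex_eq_iff)

lemma herm_13: "herm (G1 u) (G3 u) = - of_real (2 * inv_b G u)"
  using vector_derivative_of_constant[OF has_vector_derivative_herm[OF frame_deriv(2,3)] herm_12, of u]
  by (simp add: herm_22 add_eq_0_iff2)

text \<open>The real part comes from differentiating \<open>herm_22\<close>, the imaginary part from
  a = 1, with the sign reversed by conjugation.\<close>

lemma herm_23:
  assumes "(inv_b G has_real_derivative b') (at u)"
  shows "herm (G2 u) (G3 u) = of_real b' - \<i>"
proof -
  have "((\<lambda>u. herm (G2 u) (G2 u)) has_vector_derivative herm (G3 u) (G2 u) + herm (G2 u) (G3 u)) (at u)"
    by (rule has_vector_derivative_herm[OF frame_deriv(3,3)])
  moreover have "((\<lambda>u. herm (G2 u) (G2 u)) has_vector_derivative of_real (2 * b')) (at u)"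
    unfolding herm_22
    by (intro has_vector_derivative_of_real)
       (use assms in \<open>auto intro!: derivative_eq_intros simp: has_real_derivative_iff_has_vector_derivative\<close>)
  ultimately have "herm (G3 u) (G2 u) + herm (G2 u) (G3 u) = of_real (2 * b')"
    by (rule vector_derivative_unique_at)
  moreover have "cnj (herm (G2 u) (G3 u)) = herm (G3 u) (G2 u)"
    by (rule cnj_herm)
  moreover have "Im (herm (G3 u) (G2 u)) = 1"
    using inv_a_eq_1[of u] by (simp add: inv_a_def G2_def G3_def)
  ultimately show ?thesis
    by (auto simp: complex_eq_iff)
qed

lemmas gram = herm_00 herm_01 herm_02 herm_10 herm_11 herm_12 herm_20 herm_21 herm_22

text \<open>The coefficients come from inverting the Gram matrix; the difference of the two sides is
  orthogonal to the frame.\<close>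

lemma frame_expansion:
  "x = - (herm (G2 u) x + 2 * of_real (inv_b G u) * herm (G u) x) *s G u
     + herm (G1 u) x *s G1 u - herm (G u) x *s G2 u"
  (is "x = ?y")
proof -
  have "x - ?y = 0"
    by (rule herm_orthogonal_frame_imp_zero[where ?x1.0 = "G u" and ?x2.0 = "G1 u" and ?x3.0 = "G2 u"])
       (simp_all add: herm_simps gram det_frame)
  then show ?thesis by simp
qed

lemma G3_eq:
  assumes "(inv_b G has_real_derivative b') (at u)"
  shows "G3 u = (\<i> - of_real b') *s G u - of_real (2 * inv_b G u) *s G1 u"
  by (subst frame_expansion[of "G3 u" u])
     (simp add: herm_03 herm_13 herm_23[OF assms] vec_eq_iff)

text \<open>The hypotheses are g''' = -2 kappa g' + (i - kappa') g as a first-order system. The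
  vector rebuilt from (g, g1, g2) at each point has derivative zero, because the frame obeys the
  structure equation \<open>G3_eq\<close>.\<close>

lemma scalar_solution_represented:
  fixes g g1 g2 :: "real \<Rightarrow> complex"
  assumes b: "\<And>u. (inv_b G has_real_derivative b' u) (at u)"
    and g: "\<And>u. (g has_vector_derivative g1 u) (at u)"
    and g1: "\<And>u. (g1 has_vector_derivative g2 u) (at u)"
    and g2: "\<And>u. (g2 has_vector_derivative
          - 2 * of_real (inv_b G u) * g1 u + (\<i> - of_real (b' u)) * g u) (at u)"
  obtains v where "\<And>u. herm v (G u) = g u" "\<And>u. herm v (G1 u) = g1 u" "\<And>u. herm v (G2 u) = g2 u"
proof -
  \<comment> \<open>the vector whose products with the frame at \<open>u\<close> are \<open>g u\<close>, \<open>g1 u\<close>, \<open>g2 u\<close>\<close>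
  define v where "v u = - (cnj (g2 u) + 2 * of_real (inv_b G u) * cnj (g u)) *s G u
    + cnj (g1 u) *s G1 u - cnj (g u) *s G2 u" for u
  have b_of_real: "((\<lambda>u. complex_of_real (inv_b G u)) has_vector_derivative of_real (b' u)) (at u)" for u
    using b[of u] has_vector_derivative_of_real[of "inv_b G" "b' u"]
    by (simp add: has_real_derivative_iff_has_vector_derivative)
  have "((\<lambda>u. v u $ i) has_vector_derivative 0) (at u)" for u i
    unfolding v_def vector_minus_component vector_add_component vector_smult_component
    by (auto intro!: derivative_eq_intros b g g1 g2 b_of_real frame_deriv
        simp: G3_eq[OF b] algebra_simps)
  then have "v u $ i = v 0 $ i" for u i
    by (rule zero_vector_derivative_imp_eq)
  then have v: "v 0 = v u" for u
    by (metis vec_eq_iff)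
  show ?thesis
  proof (rule that[of "v 0"])
    fix u
    show "herm (v 0) (G u) = g u" "herm (v 0) (G1 u) = g1 u" "herm (v 0) (G2 u) = g2 u"
      by (simp_all only: v[of u]) (simp_all add: v_def herm_simps gram)
  qed
qed

end

section \<open>Eigenfunctions and closedness\<close>

lemma has_vector_derivative_shift:
  fixes f :: "real \<Rightarrow> 'a::real_normed_vector"
  assumes "\<And>u. (f has_vector_derivative f' u) (at u)"
  shows "((\<lambda>u. f (u + T)) has_vector_derivative f' (u + T)) (at u)"
proof -
  have "((\<lambda>u. u + T) has_vector_derivative 1) (at u)"
    by (auto intro!: derivative_eq_intros)
  from vector_diff_chain_at[OF this assms] show ?thesis
    by (simp add: o_def)
qed

lemma has_vector_derivative_exp_complex:
  fixes Q :: "real \<Rightarrow> complex"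
  assumes "(Q has_vector_derivative Q') (at u)"
  shows "((\<lambda>u. exp (Q u)) has_vector_derivative Q' * exp (Q u)) (at u)"
  using field_vector_diff_chain_at[OF assms DERIV_exp] by (simp add: o_def)

text \<open>Rolle's theorem, in the form that excludes periodicity for nonreal and for double
  roots.\<close>

lemma derivative_zero_of_equal_values:
  fixes f :: "real \<Rightarrow> real"
  assumes "\<And>u. (f has_real_derivative f' u) (at u)" "a < b" "f a = f b"
  obtains z where "f' z = 0"
proof -
  obtain z where "f b - f a = (b - a) * f' z"
    using MVT2[of a b f f'] assms by blast
  then show ?thesis using assms that by auto
qed

lemma continuous_on_of_vector_derivative:
  assumes "\<And>u. (f has_vector_derivative f' u) (at u)"
  shows "continuous_on S f"
  using assms has_vector_derivative_continuous continuous_at_imp_continuous_on by blast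

locale string_lift = legendrian_frame G + string_curvature m l u0
  for G :: "real \<Rightarrow> complex^3" and m l u0 :: real +
  assumes inv_b_kappa: "inv_b G u = kappa_ml m l (u + u0)"
begin

lemma inv_b_eq: "inv_b G = k"
  using inv_b_kappa by (auto simp: k_def)

text \<open>The Riccati equation gives the second derivative of \<open>exp (Q u)\<close>, the
  formula for \<open>log_deriv\<close> the third. The products with \<open>G1\<close> and
  \<open>G2\<close> are recorded because they later separate the eigenvectors.\<close>

lemma eigenfunction_represented:
  assumes root: "charpoly \<mu> = 0"
    and Q: "\<And>u. (Q has_vector_derivative log_deriv \<mu> u) (at u)"
  obtains v where "\<And>u. herm v (G u) = exp (Q u)"
    "\<And>u. herm v (G1 u) = log_deriv \<mu> u * exp (Q u)"
    "\<And>u. herm v (G2 u) = (\<mu> - 4/3 * of_real (k u)) * exp (Q u)"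
proof (rule scalar_solution_represented)
  fix u
  show "(inv_b G has_real_derivative k1 u) (at u)"
    unfolding inv_b_eq by (rule k_deriv)
  show e: "((\<lambda>u. exp (Q u)) has_vector_derivative log_deriv \<mu> u * exp (Q u)) (at u)"
    by (rule has_vector_derivative_exp_complex[OF Q])
  show "((\<lambda>u. log_deriv \<mu> u * exp (Q u)) has_vector_derivative
      (\<mu> - 4/3 * of_real (k u)) * exp (Q u)) (at u)"
    using has_vector_derivative_mult[OF log_deriv_vderiv[OF root] e]
    by (rule has_vector_derivative_eq_rhs) (simp add: algebra_simps power2_eq_square)
  have "log_deriv \<mu> u * den \<mu> u = 3 * \<i> + of_real (k1 u)"
    using den_nonzero[OF root] by (simp add: log_deriv_def)
  \<comment> \<open>A third of the relation defining \<open>log_deriv\<close>; it removes mu from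
    the third derivative.\<close>
  then have alg: "(\<mu> + 2/3 * of_real (k u)) * log_deriv \<mu> u = \<i> + of_real (k1 u) / 3"
    by (simp add: den_def field_simps)
  have "((\<lambda>u. (\<mu> - 4/3 * of_real (k u)) * exp (Q u)) has_vector_derivative
      (\<mu> - 4/3 * of_real (k u)) * (log_deriv \<mu> u * exp (Q u)) - 4/3 * of_real (k1 u) * exp (Q u)) (at u)"
    by (auto intro!: derivative_eq_intros e simp: algebra_simps)
  also have "(\<mu> - 4/3 * of_real (k u)) * (log_deriv \<mu> u * exp (Q u)) - 4/3 * of_real (k1 u) * exp (Q u)
    = ((\<mu> + 2/3 * of_real (k u)) * log_deriv \<mu> u - 2 * of_real (k u) * log_deriv \<mu> u
        - 4/3 * of_real (k1 u)) * exp (Q u)"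
    by (simp add: field_simps)
  also have "\<dots> = - 2 * of_real (inv_b G u) * (log_deriv \<mu> u * exp (Q u))
      + (\<i> - of_real (k1 u)) * exp (Q u)"
    unfolding alg inv_b_eq by (simp add: field_simps)
  finally show "((\<lambda>u. (\<mu> - 4/3 * of_real (k u)) * exp (Q u)) has_vector_derivative
      - 2 * of_real (inv_b G u) * (log_deriv \<mu> u * exp (Q u))
      + (\<i> - of_real (k1 u)) * exp (Q u)) (at u)" .
qed (use that in blast)

lemma double_root_identity:
  assumes root: "charpoly \<mu> = 0" and double: "9 * \<mu>\<^sup>2 = of_real C1"
  shows "27 + 3 * (of_real (k1 u))\<^sup>2 - 3 * (\<mu> - 4/3 * of_real (k u)) * (den \<mu> u)\<^sup>2 = (den \<mu> u)^3"
proof -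
  \<comment> \<open>This is \<open>charpoly_root\<close> differentiated in mu, which is legitimate
    since \<open>double\<close> says that the derivative of \<open>charpoly\<close> vanishes at the
    root.\<close>
  have "3 * (of_real C1 - 4 * (of_real (k u))\<^sup>2)
      = (den \<mu> u)\<^sup>2 + 6 * (\<mu> - 4/3 * of_real (k u)) * den \<mu> u"
    unfolding double[symmetric] den_def by (simp add: power2_eq_square algebra_simps)
  then show ?thesis
    using charpoly_root[OF root, of u] by algebra
qed

text \<open>A double root produces the Jordan chain $P(fg) = \mu fg + g$.\<close>

lemma generalized_eigenfunction_represented:
  assumes root: "charpoly \<mu> = 0" and double: "9 * \<mu>\<^sup>2 = of_real C1"
    and Q: "\<And>u. (Q has_vector_derivative log_deriv \<mu> u) (at u)"
    and f: "\<And>u. (f has_vector_derivative - 3 * log_deriv \<mu> u * inverse (den \<mu> u)) (at u)"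
  obtains v where "\<And>u. herm v (G u) = f u * exp (Q u)"
proof (rule scalar_solution_represented)
  fix u
  \<comment> \<open>The derivative prescribed for \<open>f\<close> is that of
    \<open>log_deriv\<close> with respect to mu. So \<open>f\<close> times the eigenfunction is
    formally its mu-derivative, up to a multiple of the eigenfunction.\<close>
  let ?s = "log_deriv \<mu> u" and ?A = "\<mu> - 4/3 * of_real (k u)" and ?D = "den \<mu> u"
  note nz = den_nonzero[OF root, of u]
  have sD: "?s * ?D = 3 * \<i> + of_real (k1 u)"
    using nz by (simp add: log_deriv_def)
  have e: "((\<lambda>u. exp (Q u)) has_vector_derivative ?s * exp (Q u)) (at u)"
    by (rule has_vector_derivative_exp_complex[OF Q])
  note inv = has_vector_derivative_inverse_complex[OF den_vderiv nz]
  show "(inv_b G has_real_derivative k1 u) (at u)"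
    unfolding inv_b_eq by (rule k_deriv)
  show "((\<lambda>u. f u * exp (Q u)) has_vector_derivative
      (f u * log_deriv \<mu> u - 3 * log_deriv \<mu> u * inverse (den \<mu> u)) * exp (Q u)) (at u)"
    using has_vector_derivative_mult[OF f e]
    by (rule has_vector_derivative_eq_rhs) (simp add: algebra_simps)
  have "((\<lambda>u. (f u * log_deriv \<mu> u - 3 * log_deriv \<mu> u * inverse (den \<mu> u)) * exp (Q u))
    has_vector_derivative
      (f u * (?A - ?s\<^sup>2) + (- 3 * ?s * inverse ?D) * ?s
        - 3 * ((?A - ?s\<^sup>2) * inverse ?D + ?s * (- (2 * of_real (k1 u)) / ?D\<^sup>2))) * exp (Q u)
      + (f u * ?s - 3 * ?s * inverse ?D) * (?s * exp (Q u))) (at u)"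
    by (auto intro!: derivative_eq_intros f e inv log_deriv_vderiv[OF root] simp: algebra_simps)
  also have "(f u * (?A - ?s\<^sup>2) + (- 3 * ?s * inverse ?D) * ?s
        - 3 * ((?A - ?s\<^sup>2) * inverse ?D + ?s * (- (2 * of_real (k1 u)) / ?D\<^sup>2))) * exp (Q u)
      + (f u * ?s - 3 * ?s * inverse ?D) * (?s * exp (Q u))
    = (f u * ?A + (- 3 * (?s * ?D)\<^sup>2 - 3 * ?A * ?D\<^sup>2 + 6 * (?s * ?D) * of_real (k1 u)) / ?D^3) * exp (Q u)"
    using nz by (simp add: field_simps power2_eq_square power3_eq_cube)
  also have "- 3 * (?s * ?D)\<^sup>2 - 3 * ?A * ?D\<^sup>2 + 6 * (?s * ?D) * of_real (k1 u)
    = 27 + 3 * (of_real (k1 u))\<^sup>2 - 3 * ?A * ?D\<^sup>2"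
    unfolding sD by (simp add: power2_eq_square algebra_simps)
  also have "\<dots> = ?D^3"
    by (rule double_root_identity[OF root double])
  finally show "((\<lambda>u. (f u * log_deriv \<mu> u - 3 * log_deriv \<mu> u * inverse (den \<mu> u)) * exp (Q u))
    has_vector_derivative (f u * (\<mu> - 4/3 * of_real (k u)) + 1) * exp (Q u)) (at u)"
    using nz by simp
  have kd: "((\<lambda>u. \<mu> - 4/3 * complex_of_real (k u)) has_vector_derivative - (4/3) * of_real (k1 u)) (at u)"
    by (auto intro!: derivative_eq_intros)
  have "((\<lambda>u. (f u * (\<mu> - 4/3 * of_real (k u)) + 1) * exp (Q u)) has_vector_derivative
     (f u * (- (4/3) * of_real (k1 u)) + (- 3 * ?s * inverse ?D) * ?A) * exp (Q u)
      + (f u * ?A + 1) * (?s * exp (Q u))) (at u)"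
    by (auto intro!: derivative_eq_intros f e kd)
  \<comment> \<open>The last line of the right-hand side is zero: its two summands vanish by
    \<open>sD\<close> and by the definition of \<open>den\<close>.\<close>
  also have "(f u * (- (4/3) * of_real (k1 u)) + (- 3 * ?s * inverse ?D) * ?A) * exp (Q u)
      + (f u * ?A + 1) * (?s * exp (Q u))
    = - 2 * of_real (inv_b G u) * ((f u * ?s - 3 * ?s * inverse ?D) * exp (Q u))
      + (\<i> - of_real (k1 u)) * (f u * exp (Q u))
      + (f u * (?s * ?D - 3 * \<i> - of_real (k1 u)) / 3
         + ?s * inverse ?D * (?D - 3 * \<mu> - 2 * of_real (k u)) ) * exp (Q u)"
    using nz unfolding inv_b_eq by (simp add: field_simps) (simp add: den_def algebra_simps)
  finally show "((\<lambda>u. (f u * (\<mu> - 4/3 * of_real (k u)) + 1) * exp (Q u)) has_vector_derivative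
      - 2 * of_real (inv_b G u) * ((f u * ?s - 3 * ?s * inverse ?D) * exp (Q u))
      + (\<i> - of_real (k1 u)) * (f u * exp (Q u))) (at u)"
    unfolding sD by (simp add: den_def)
qed (use that in blast)

text \<open>Projective closedness only provides a factor depending on \<open>u\<close>, with no
  regularity. Expressing it as a Hermitian product makes it differentiable, and differentiating c^3
  = 1 makes it constant. Being unimodular, it preserves the product of \<open>G2\<close> with
  itself, so kappa has period \<open>T\<close>.\<close>

lemma closed_curve_multiplier:
  assumes "closed_curve G"
  obtains T c where "0 < T" "c^3 = 1" "\<And>u. G (u + T) = c *s G u" "\<And>u. k (u + T) = k u"
proof -
  obtain T d where T: "0 < T" and d: "\<And>u. G (u + T) = d u *s G u"
    using assms unfolding closed_curve_def by metis
  \<comment> \<open>The Gram determinant of the frames at \<open>u\<close> and \<open>u + T\<close> equals $-c^3$, whence $c^3 = 1$.\<close>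
  define c where "c u = - herm (G2 u) (G (u + T))" for u
  have c: "d u = c u" for u
    by (simp add: c_def d herm_simps gram)
  note H = d[unfolded c]
  note H_deriv = has_vector_derivative_shift[OF frame_deriv(1), of T]
    has_vector_derivative_shift[OF frame_deriv(2), of T]
    has_vector_derivative_shift[OF frame_deriv(3), of T]
  have 0: "herm (G u) (G (u + T)) = 0" "herm (G1 u) (G (u + T)) = 0"
    "herm (G2 u) (G (u + T)) = - c u" for u
    by (simp_all add: H herm_simps gram)
  have 1: "herm (G u) (G1 (u + T)) = 0" for u
    using vector_derivative_of_constant[OF has_vector_derivative_herm[OF frame_deriv(1) H_deriv(1)] 0(1)]
      0(2) by simp
  have 2: "herm (G1 u) (G1 (u + T)) = c u" for u
    using vector_derivative_of_constant[OF has_vector_derivative_herm[OF frame_deriv(2) H_deriv(1)] 0(2), of u]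
      0(3)[of u] by simp
  have 3: "herm (G u) (G2 (u + T)) = - c u" for u
    using vector_derivative_of_constant[OF has_vector_derivative_herm[OF frame_deriv(1) H_deriv(2)] 1, of u]
      2[of u] by (simp add: add_eq_0_iff)
  have cube: "c u ^ 3 = 1" for u
    using det_herm_vectors[of "G u" "G (u + T)" "G1 u" "G1 (u + T)" "G2 u" "G2 (u + T)"]
    by (simp add: 0 1 2 3 det_frame power3_eq_cube)
  have c_deriv: "(c has_vector_derivative - (herm (G3 u) (G (u + T)) + herm (G2 u) (G1 (u + T)))) (at u)" for u
    unfolding c_def[abs_def]
    by (intro has_vector_derivative_minus has_vector_derivative_herm frame_deriv H_deriv)
  have "(c has_vector_derivative 0) (at u)" for u
  proof -
    let ?c' = "- (herm (G3 u) (G (u + T)) + herm (G2 u) (G1 (u + T)))"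
    have "((\<lambda>u. c u * (c u * c u)) has_vector_derivative 3 * (c u)\<^sup>2 * ?c') (at u)"
      by (auto intro!: derivative_eq_intros c_deriv simp: power2_eq_square algebra_simps)
    then have "3 * (c u)\<^sup>2 * ?c' = 0"
      by (rule vector_derivative_of_constant[where c = 1])
         (use cube in \<open>simp add: power3_eq_cube mult.assoc\<close>)
    moreover have "c u \<noteq> 0"
      using cube[of u] by auto
    ultimately have "?c' = 0" by simp
    then show ?thesis using c_deriv[of u] by simp
  qed
  then have const: "c u = c 0" for u
    by (rule zero_vector_derivative_imp_eq)
  have G: "G (u + T) = c 0 *s G u" for u
    using H const[of u] by simp
  have scale: "((\<lambda>u. c 0 *s f u) has_vector_derivative c 0 *s f') (at u)"
    if "(f has_vector_derivative f') (at u)" for f :: "real \<Rightarrow> complex^3" and f' u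
  proof -
    have "bounded_linear (\<lambda>x :: complex^3. c 0 *s x)"
      by (rule linear_conv_bounded_linear[THEN iffD1], rule linearI)
         (simp_all add: vec_eq_iff algebra_simps)
    from bounded_linear.has_vector_derivative[OF this that] show ?thesis .
  qed
  have G1: "G1 (u + T) = c 0 *s G1 u" for u
    using H_deriv(1)[of u] scale[OF frame_deriv(1)[of u]]
    unfolding G by (rule vector_derivative_unique_at)
  have G2: "G2 (u + T) = c 0 *s G2 u" for u
    using H_deriv(2)[of u] scale[OF frame_deriv(2)[of u]]
    unfolding G1 by (rule vector_derivative_unique_at)
  have "norm (c 0) ^ 3 = 1"
    using cube[of 0] by (metis norm_one norm_power)
  then have "norm (c 0) = 1"
    using power_eq_iff_eq_base[of 3 "norm (c 0)" 1] by simp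
  then have "c 0 * cnj (c 0) = 1"
    by (simp add: complex_norm_square[symmetric])
  then have "herm (G2 (u + T)) (G2 (u + T)) = herm (G2 u) (G2 u)" for u
    by (simp add: G2 herm_simps flip: mult.assoc)
  then have "inv_b G (u + T) = inv_b G u" for u
    unfolding herm_22 of_real_eq_iff by simp
  then show ?thesis
    using that[OF T cube G] by (simp add: inv_b_eq)
qed

text \<open>Pairing with the constant vector that represents the eigenfunction transfers the factor
  of \<open>G\<close> to it, so all roots share the same multiplier.\<close>

lemma eigenfunction_multiplier:
  assumes root: "charpoly \<mu> = 0"
    and Q: "\<And>u. (Q has_vector_derivative log_deriv \<mu> u) (at u)"
    and G: "\<And>u. G (u + T) = c *s G u"
  shows "exp (Q (u + T)) = c * exp (Q u)"
proof -
  obtain v where v: "\<And>u. herm v (G u) = exp (Q u)"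
    using eigenfunction_represented[OF root Q] by metis
  show ?thesis
    using v[of "u + T"] v[of u] G[of u] by (simp add: herm_simps)
qed

lemma primitive_log_deriv:
  assumes "charpoly \<mu> = 0"
  shows "(primitive (log_deriv \<mu>) has_vector_derivative log_deriv \<mu> u) (at u)"
  by (intro primitive_has_vector_derivative
      continuous_on_of_vector_derivative[OF log_deriv_vderiv[OF assms]])

text \<open>The common multiplier has modulus 1, while a nonreal root would make a quantity built
  from |g| and kappa drift in one direction.\<close>

lemma closed_imp_root_real:
  assumes closed: "closed_curve G" and root: "charpoly \<mu> = 0"
  shows "Im \<mu> = 0"
proof (rule ccontr)
  assume y: "Im \<mu> \<noteq> 0"
  obtain T c where T: "0 < T" "c^3 = 1" "\<And>u. G (u + T) = c *s G u" "\<And>u. k (u + T) = k u"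
    using closed_curve_multiplier[OF closed] by metis
  define Q where "Q = primitive (log_deriv \<mu>)"
  have Q: "(Q has_vector_derivative log_deriv \<mu> u) (at u)" for u
    unfolding Q_def by (rule primitive_log_deriv[OF root])
  have "norm c ^ 3 = 1"
    using T(2) by (metis norm_one norm_power)
  then have "norm c = 1"
    using power_eq_iff_eq_base[of 3 "norm c" 1] by simp
  then have ReQ: "Re (Q (u + T)) = Re (Q u)" for u
    using arg_cong[OF eigenfunction_multiplier[OF root Q T(3), of u], of norm]
    by (simp add: norm_mult)
  \<comment> \<open>$|g|^2/|3\mu+2\kappa|$ is strictly monotone, yet it would have period \<open>T\<close>\<close>
  define x where "x u = 3 * Re \<mu> + 2 * k u" for u
  define N where "N u = (x u)\<^sup>2 + (3 * Im \<mu>)\<^sup>2" for u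
  have N: "0 < N u" for u
    using y by (simp add: N_def add_nonneg_pos)
  have Re_log: "Re (log_deriv \<mu> u) = (k1 u * x u + 9 * Im \<mu>) / N u" for u
    by (simp add: log_deriv_def den_def Re_divide x_def N_def)
  have "((\<lambda>u. Re (Q u)) has_real_derivative Re (log_deriv \<mu> u)) (at u)" for u
    using bounded_linear.has_vector_derivative[OF bounded_linear_Re Q[of u]]
    by (simp add: has_real_derivative_iff_has_vector_derivative)
  moreover have "((\<lambda>u. ln (N u)) has_real_derivative (4 * k1 u * x u) / N u) (at u)" for u
    unfolding N_def x_def
    by (rule derivative_eq_intros refl k_deriv | use N[of u] in \<open>simp add: N_def x_def\<close>)+
  ultimately have "((\<lambda>u. 2 * Re (Q u) - ln (N u) / 2) has_real_derivative
      2 * Re (log_deriv \<mu> u) - (4 * k1 u * x u) / N u / 2) (at u)" for u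
    by (intro DERIV_diff DERIV_cmult DERIV_cdivide)
  moreover have "2 * Re (log_deriv \<mu> u) - (4 * k1 u * x u) / N u / 2 = 18 * Im \<mu> / N u" for u
    unfolding Re_log by (simp add: add_divide_distrib)
  ultimately have "((\<lambda>u. 2 * Re (Q u) - ln (N u) / 2) has_real_derivative 18 * Im \<mu> / N u) (at u)" for u
    by simp
  moreover have "2 * Re (Q 0) - ln (N 0) / 2 = 2 * Re (Q T) - ln (N T) / 2"
    using ReQ[of 0] T(4)[of 0] by (simp add: N_def x_def)
  ultimately obtain z where "18 * Im \<mu> / N z = 0"
    using derivative_zero_of_equal_values[of "\<lambda>u. 2 * Re (Q u) - ln (N u) / 2" "\<lambda>u. 18 * Im \<mu> / N u" 0 T]
      T(1) by blast
  then show False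
    using y N[of z] by simp
qed

lemma den_of_real: "den (of_real r) u = of_real (3 * r + 2 * k u)"
  by (simp add: den_def)

lemma real_den_nonzero: "charpoly (of_real r) = 0 \<Longrightarrow> 3 * r + 2 * k u \<noteq> 0"
  using den_nonzero[of "of_real r" u] unfolding den_of_real by (metis of_real_0)

text \<open>For a double root the Jordan chain forces \<open>f\<close> to return to its value after
  \<open>T\<close>, yet Im f has a derivative that is negative everywhere.\<close>

lemma closed_imp_root_simple:
  assumes closed: "closed_curve G" and root: "charpoly (of_real r) = 0"
  shows "9 * r\<^sup>2 \<noteq> C1"
proof
  assume "9 * r\<^sup>2 = C1"
  then have double: "9 * (complex_of_real r)\<^sup>2 = of_real C1"
    by (metis of_real_mult of_real_numeral of_real_power)
  obtain T c where T: "0 < T" "c^3 = 1" "\<And>u. G (u + T) = c *s G u"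
    using closed_curve_multiplier[OF closed] by metis
  define Q where "Q = primitive (log_deriv r)"
  have Q: "(Q has_vector_derivative log_deriv r u) (at u)" for u
    unfolding Q_def by (rule primitive_log_deriv[OF root])
  define f where "f = primitive (\<lambda>u. - 3 * log_deriv r u * inverse (den r u))"
  have f: "(f has_vector_derivative - 3 * log_deriv r u * inverse (den r u)) (at u)" for u
    unfolding f_def
    by (intro primitive_has_vector_derivative continuous_intros
        continuous_on_of_vector_derivative[OF log_deriv_vderiv[OF root]]
        continuous_on_of_vector_derivative[OF den_vderiv])
       (use den_nonzero[OF root] in auto)
  obtain v where v: "\<And>u. herm v (G u) = f u * exp (Q u)"
    using generalized_eigenfunction_represented[OF root double Q f] by metis
  \<comment> \<open>Both the eigenfunction and its product with \<open>f\<close> are multiplied by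
    \<open>c\<close>, hence \<open>f\<close> itself is unchanged.\<close>
  have "f (0 + T) * (c * exp (Q 0)) = c * (f 0 * exp (Q 0))"
    using v[of "0 + T", unfolded T(3) herm_scale_right v eigenfunction_multiplier[OF root Q T(3)]]
    by (rule sym)
  moreover have "c \<noteq> 0"
    using T(2) by auto
  ultimately have fT: "f T = f 0"
    by simp
  have Im_deriv: "Im (- 3 * log_deriv r u * inverse (den r u)) = - 9 / (3 * r + 2 * k u)\<^sup>2" for u
  proof -
    have "- 3 * log_deriv r u * inverse (den r u)
      = (- 9 * \<i> - of_real (3 * k1 u)) / of_real ((3 * r + 2 * k u)\<^sup>2)"
      unfolding log_deriv_def den_of_real by (simp add: divide_simps power2_eq_square algebra_simps)
    then show ?thesis
      by (simp only: Im_divide_of_real) simp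
  qed
  have "((\<lambda>u. Im (f u)) has_real_derivative - 9 / (3 * r + 2 * k u)\<^sup>2) (at u)" for u
    using bounded_linear.has_vector_derivative[OF bounded_linear_Im f[of u]]
    unfolding Im_deriv by (simp add: has_real_derivative_iff_has_vector_derivative)
  moreover have "Im (f 0) = Im (f T)"
    using fT by simp
  ultimately obtain z where "- 9 / (3 * r + 2 * k z)\<^sup>2 = 0"
    using derivative_zero_of_equal_values[of "\<lambda>u. Im (f u)" "\<lambda>u. - 9 / (3 * r + 2 * k u)\<^sup>2" 0 T] T(1)
    by blast
  then show False
    using real_den_nonzero[OF root, of z] by simp
qed

section \<open>Real roots: explicit eigenfunctions and their phases\<close>

definition phase :: "real \<Rightarrow> real \<Rightarrow> real" where
  "phase r u = (let N = 2 * (1 + m) * l\<^sup>2 + 6 * r in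
     6 / (N * l) * primitive (\<lambda>t. 1 / ((1 - 6 * m * l\<^sup>2 / N * (sin t)\<^sup>2) * Delta t)) (phi u))"

text \<open>The phase is a primitive of $3/(3r+2\kappa)$, written as an incomplete integral of the
  third kind in the amplitude.\<close>

lemma phase_properties:
  assumes root: "charpoly (of_real r) = 0"
  shows phase_deriv: "(phase r has_real_derivative 3 / (3 * r + 2 * k u)) (at u)"
    and phase_add_period: "phase r (u + period) = phase r u + 2 * pi * Theta (2 * r) m l"
proof -
  define N where "N = 2 * (1 + m) * l\<^sup>2 + 6 * r"
  define n where "n = 6 * m * l\<^sup>2 / N"
  define P where "P = primitive (\<lambda>t. 1 / ((1 - n * (sin t)\<^sup>2) * Delta t))"
  note d = real_den_nonzero[OF root]
  have NS: "2 * (3 * r + 2 * k u) = N - 6 * m * l\<^sup>2 * (sin (phi u))\<^sup>2" for u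
    by (simp add: k_eq N_def field_simps)
  have N: "N \<noteq> 0"
  proof -
    obtain u where "phi u = 0" using phi_surj by blast
    then show ?thesis using NS[of u] d[of u] by auto
  qed
  have Nn: "2 * (3 * r + 2 * k u) = N * (1 - n * (sin (phi u))\<^sup>2)" for u
    unfolding NS n_def using N by (simp add: field_simps)
  \<comment> \<open>Surjectivity of the amplitude carries the nonvanishing of 3r + 2 kappa over to
    every \<open>t\<close>, so the integrand has no poles.\<close>
  have nz: "1 - n * (sin t)\<^sup>2 \<noteq> 0" for t
  proof -
    obtain u where "phi u = t" using phi_surj by blast
    then show ?thesis using Nn[of u] d[of u] by auto
  qed
  have cont: "continuous_on UNIV (\<lambda>t. 1 / ((1 - n * (sin t)\<^sup>2) * Delta t))"
    by (intro continuous_intros) (use nz Delta_pos in \<open>auto simp: less_imp_neq[symmetric]\<close>)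
  have phase: "phase r u = 6 / (N * l) * P (phi u)" for u
    unfolding phase_def Let_def P_def n_def N_def by (rule refl)
  have P: "(P has_real_derivative 1 / ((1 - n * (sin t)\<^sup>2) * Delta t)) (at t)" for t
    unfolding P_def has_real_derivative_iff_has_vector_derivative
    by (rule primitive_has_vector_derivative[OF cont])
  have "(phase r has_real_derivative
      6 / (N * l) * (1 / ((1 - n * (sin (phi u))\<^sup>2) * Delta (phi u)) * (l * Delta (phi u)))) (at u)"
    unfolding phase by (intro DERIV_cmult DERIV_chain2[OF P] phi_deriv)
  also have "6 / (N * l) * (1 / ((1 - n * (sin (phi u))\<^sup>2) * Delta (phi u)) * (l * Delta (phi u)))
     = 6 / (N * (1 - n * (sin (phi u))\<^sup>2))"
    using l_pos Delta_pos[of "phi u"] by simp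
  also have "\<dots> = 3 / (3 * r + 2 * k u)"
    unfolding Nn[symmetric] using d[of u] by (simp add: field_simps)
  finally show "(phase r has_real_derivative 3 / (3 * r + 2 * k u)) (at u)" .
  have "P (phi u + pi) = P (phi u) + 2 * P (pi / 2)"
    unfolding P_def by (rule primitive_even_add_period[OF cont]) simp_all
  moreover have "P (pi / 2) = ellPi n m"
    by (simp add: P_def primitive_def ellPi_def Delta_def)
  moreover have "Theta (2 * r) m l = 6 * ellPi n m / (pi * l * N)"
    by (simp add: Theta_def n_def N_def)
  ultimately show "phase r (u + period) = phase r u + 2 * pi * Theta (2 * r) m l"
    using N l_pos by (simp add: phase phi_add_period field_simps)
qed

text \<open>A logarithm of the eigenfunction of modulus |3r + 2 kappa|^(1/2). The square inside
  \<open>ln\<close> covers both signs of 3r + 2 kappa; the real part is periodic, so the phase alone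
  determines the multiplier.\<close>

definition log_eigen :: "real \<Rightarrow> real \<Rightarrow> complex" where
  "log_eigen r u = of_real (ln ((3 * r + 2 * k u)\<^sup>2) / 4) + \<i> * of_real (phase r u)"

lemma log_eigen_deriv:
  assumes root: "charpoly (of_real r) = 0"
  shows "(log_eigen r has_vector_derivative log_deriv (of_real r) u) (at u)"
proof -
  note nz = real_den_nonzero[OF root, of u]
  have sq: "0 < (3 * r + 2 * k u)\<^sup>2"
    using nz by simp
  have "((\<lambda>u. (3 * r + 2 * k u)\<^sup>2) has_real_derivative 2 * (3 * r + 2 * k u) * (2 * k1 u)) (at u)"
    by (auto intro!: derivative_eq_intros k_deriv)
  from DERIV_cdivide[OF DERIV_chain2[OF DERIV_ln[OF sq] this], of 4]
  have "((\<lambda>u. ln ((3 * r + 2 * k u)\<^sup>2) / 4) has_real_derivative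
      inverse ((3 * r + 2 * k u)\<^sup>2) * (2 * (3 * r + 2 * k u) * (2 * k1 u)) / 4) (at u)" .
  also have "inverse ((3 * r + 2 * k u)\<^sup>2) * (2 * (3 * r + 2 * k u) * (2 * k1 u)) / 4
      = k1 u / (3 * r + 2 * k u)"
    using nz by (simp add: divide_simps power2_eq_square)
  finally have "((\<lambda>u. ln ((3 * r + 2 * k u)\<^sup>2) / 4) has_real_derivative k1 u / (3 * r + 2 * k u)) (at u)" .
  then have "(log_eigen r has_vector_derivative
      of_real (k1 u / (3 * r + 2 * k u)) + \<i> * of_real (3 / (3 * r + 2 * k u))) (at u)"
    unfolding log_eigen_def[abs_def]
    by (intro has_vector_derivative_add has_vector_derivative_mult_right has_vector_derivative_of_real)
       (use phase_deriv[OF root] in \<open>simp_all add: has_real_derivative_iff_has_vector_derivative\<close>)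
  also have "of_real (k1 u / (3 * r + 2 * k u)) + \<i> * of_real (3 / (3 * r + 2 * k u))
     = log_deriv (of_real r) u"
    unfolding log_deriv_def den_of_real by (simp add: add_divide_distrib)
  finally show ?thesis .
qed

lemma k_add_periods: "k (u + real n * period) = k u"
proof (induction n)
  case (Suc n)
  then show ?case using k_add_period[of "u + real n * period"] by (simp add: algebra_simps)
qed simp

lemma phase_add_periods:
  assumes root: "charpoly (of_real r) = 0"
  shows "phase r (u + real n * period) = phase r u + real n * (2 * pi * Theta (2 * r) m l)"
proof (induction n)
  case (Suc n)
  then show ?case using phase_add_period[OF root, of "u + real n * period"]
    by (simp add: algebra_simps)
qed simp

lemma exp_log_eigen_add_periods:
  assumes root: "charpoly (of_real r) = 0"
  shows "exp (log_eigen r (u + real n * period))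
    = exp (\<i> * of_real (2 * pi * (real n * Theta (2 * r) m l))) * exp (log_eigen r u)"
  unfolding log_eigen_def k_add_periods phase_add_periods[OF root] exp_add[symmetric]
  by (simp add: algebra_simps)

text \<open>A period of the curve is a period of kappa, hence \<open>n\<close> times
  \<open>period\<close>, and the multiplier is exp(2 pi i n Theta).\<close>

lemma closed_imp_Theta_rational:
  assumes closed: "closed_curve G" and root: "charpoly (of_real r) = 0"
  shows "Theta (2 * r) m l \<in> \<rat>"
proof -
  obtain T c where T: "0 < T" "c^3 = 1" "\<And>u. G (u + T) = c *s G u" "\<And>u. k (u + T) = k u"
    using closed_curve_multiplier[OF closed] by metis
  obtain j :: int where "T = of_int j * period"
    using k_period_imp_multiple[OF T(4)] by blast
  moreover from this have "0 < j"
    using T(1) period_pos by (simp add: zero_less_mult_iff)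
  ultimately obtain n where n: "T = real n * period" "0 < n"
    by (metis of_int_of_nat_eq of_nat_0_less_iff zero_less_imp_eq_int)
  define \<theta> where "\<theta> = Theta (2 * r) m l"
  have "exp (\<i> * of_real (2 * pi * (real n * \<theta>))) * exp (log_eigen r 0) = c * exp (log_eigen r 0)"
    using exp_log_eigen_add_periods[OF root, of 0 n]
      eigenfunction_multiplier[OF root log_eigen_deriv[OF root] T(3), of 0]
    by (simp add: n \<theta>_def)
  then have "exp (\<i> * of_real (2 * pi * (real n * \<theta>))) = c"
    by simp
  \<comment> \<open>The lift may return only up to a cube root of unity; cubing removes it and puts
    the factor 3 into the denominator of \<open>\<theta>\<close>.\<close>
  then have "exp (of_nat 3 * (\<i> * of_real (2 * pi * (real n * \<theta>)))) = 1"
    using T(2) by (simp only: exp_of_nat_mult)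
  then obtain i :: int where "3 * (2 * pi * (real n * \<theta>)) = of_int (2 * i) * pi"
    by (auto simp: exp_eq_1)
  then have "\<theta> = of_int i / (3 * real n)"
    using n(2) by (simp add: field_simps)
  then show ?thesis
    by (simp add: \<theta>_def)
qed

section \<open>Three real roots and sufficiency\<close>

text \<open>In frame coordinates the pairing with each eigenvector is a quadratic condition on
  \<open>den\<close>, and three distinct values annihilate its coefficients.\<close>

lemma orthogonal_eigenvectors_imp_zero:
  assumes root: "\<And>j. j \<in> S \<Longrightarrow> charpoly (of_real j) = 0"
    and S: "r1 \<in> S" "r2 \<in> S" "r3 \<in> S" "r1 \<noteq> r2" "r1 \<noteq> r3" "r2 \<noteq> r3"
    and v: "\<And>j. j \<in> S \<Longrightarrow> herm (v j) (G u) = g j"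
      "\<And>j. j \<in> S \<Longrightarrow> herm (v j) (G1 u) = log_deriv (of_real j) u * g j"
      "\<And>j. j \<in> S \<Longrightarrow> herm (v j) (G2 u) = (of_real j - 4/3 * of_real (k u)) * g j"
    and g: "\<And>j. j \<in> S \<Longrightarrow> g j \<noteq> 0"
    and x: "\<And>j. j \<in> S \<Longrightarrow> herm (v j) x = 0"
  shows "x = 0"
proof -
  obtain a b c where abc: "x = a *s G u + b *s G1 u + c *s G2 u"
    using frame_expansion[of x u] by (metis diff_conv_add_uminus vector_sneg_minus1 vector_smult_assoc)
  \<comment> \<open>Multiplying by \<open>den j u\<close> and writing j - (4/3) kappa as den/3 - 2
    kappa gives coefficients independent of \<open>j\<close>.\<close>
  have quad: "c / 3 * (den j u)\<^sup>2 + (a - 2 * of_real (k u) * c) * den j u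
      + b * (3 * \<i> + of_real (k1 u)) = 0" if j: "j \<in> S" for j
  proof -
    have "(a + b * log_deriv j u + c * (of_real j - 4/3 * of_real (k u))) * g j = herm (v j) x"
      unfolding abc by (simp add: herm_simps v[OF j] algebra_simps)
    then have "a + b * log_deriv j u + c * (of_real j - 4/3 * of_real (k u)) = 0"
      using x[OF j] g[OF j] by simp
    then have "(a + c * (of_real j - 4/3 * of_real (k u))) * den j u + b * (log_deriv j u * den j u) = 0"
      by algebra
    moreover have "log_deriv j u * den j u = 3 * \<i> + of_real (k1 u)"
      using den_nonzero[OF root[OF j], of u] by (simp add: log_deriv_def)
    moreover have "c / 3 * (den j u)\<^sup>2 + (a - 2 * of_real (k u) * c) * den j u
        = (a + c * (of_real j - 4/3 * of_real (k u))) * den j u"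
      by (simp add: den_def field_simps power2_eq_square)
    ultimately show ?thesis
      by simp
  qed
  have ne: "den i u \<noteq> den j u" if "i \<noteq> j" for i j :: real
    using that by (simp add: den_def)
  note zero = quadratic_three_zeros[OF quad[OF S(1)] quad[OF S(2)] quad[OF S(3)]
      ne[OF S(4)] ne[OF S(5)] ne[OF S(6)]]
  have "3 * \<i> + of_real (k1 u) \<noteq> 0"
    by (simp add: complex_eq_iff)
  then show ?thesis
    using zero by (simp add: abc)
qed

lemma charpoly_of_real: "charpoly (of_real r) = 0 \<longleftrightarrow> 9 * r^3 - 3 * C1 * r + 2 * C2 + 9 = 0"
proof -
  have "charpoly (of_real r) = of_real (9 * r^3 - 3 * C1 * r + 2 * C2 + 9)"
    by (simp add: charpoly_def)
  then show ?thesis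
    by (simp only: of_real_eq_0_iff)
qed

text \<open>The cubic has no quadratic term, so the third root is -r2 - r3 and two roots determine
  the coefficients.\<close>

lemma vieta:
  assumes "charpoly (of_real r2) = 0" "charpoly (of_real r3) = 0" "r2 \<noteq> r3"
  shows "C1 = 3 * (r2\<^sup>2 + r2 * r3 + r3\<^sup>2)" and "2 * C2 + 9 = 9 * r2 * r3 * (r2 + r3)"
proof -
  have "(r2 - r3) * (C1 - 3 * (r2\<^sup>2 + r2 * r3 + r3\<^sup>2)) = 0"
    using assms(1,2) unfolding charpoly_of_real by algebra
  then show C1: "C1 = 3 * (r2\<^sup>2 + r2 * r3 + r3\<^sup>2)"
    using assms(3) by simp
  show "2 * C2 + 9 = 9 * r2 * r3 * (r2 + r3)"
    using assms(1) C1 unfolding charpoly_of_real by algebra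
qed

text \<open>The three phases add up to arctan(kappa'/3) plus a constant, which is periodic, so their
  increments cancel.\<close>

lemma Theta_sum:
  assumes root2: "charpoly (of_real r2) = 0" and root3: "charpoly (of_real r3) = 0" and "r2 \<noteq> r3"
    and root1: "charpoly (of_real (- r2 - r3)) = 0"
  shows "Theta (2 * (- r2 - r3)) m l + Theta (2 * r2) m l + Theta (2 * r3) m l = 0"
proof -
  define r1 where "r1 = - r2 - r3"
  note root1 = root1[folded r1_def]
  note vieta = vieta[OF root2 root3 \<open>r2 \<noteq> r3\<close>]
  have "((\<lambda>u. phase r1 u + phase r2 u + phase r3 u - arctan (k1 u / 3)) has_vector_derivative 0) (at u)" for u
  proof -
    let ?d1 = "3 * r1 + 2 * k u" and ?d2 = "3 * r2 + 2 * k u" and ?d3 = "3 * r3 + 2 * k u"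
    let ?k2 = "C1 - 4 * (k u)\<^sup>2"
    note nz = real_den_nonzero[of _ u]
    \<comment> \<open>\<open>e2\<close> and \<open>e3\<close> are the second and third elementary
      symmetric functions of the denominators; their quotient is the sum of the reciprocals.\<close>
    have e2: "?d1 * ?d2 + ?d1 * ?d3 + ?d2 * ?d3 = - 3 * ?k2"
      unfolding vieta(1) r1_def by algebra
    have "3 * ((k1 u)\<^sup>2 + 9) = 6 * C1 * k u + 3 * (2 * C2 + 9) - 8 * (k u)^3"
      by (simp add: k1_squared)
    also have "\<dots> = - (?d1 * ?d2 * ?d3)"
      unfolding vieta r1_def by algebra
    finally have e3: "?d1 * ?d2 * ?d3 = - 3 * ((k1 u)\<^sup>2 + 9)"
      by simp
    have pos: "(k1 u)\<^sup>2 + 9 > 0"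
      by (simp add: add_nonneg_pos)
    have "3 / ?d1 + 3 / ?d2 + 3 / ?d3
        = 3 * (?d1 * ?d2 + ?d1 * ?d3 + ?d2 * ?d3) / (?d1 * ?d2 * ?d3)"
      using nz[OF root1] nz[OF root2] nz[OF root3] by (simp add: divide_simps) (simp add: algebra_simps)
    also have "\<dots> = 3 * ?k2 / ((k1 u)\<^sup>2 + 9)"
      unfolding e2 e3 using pos by (simp add: field_simps)
    finally have sum: "3 / ?d1 + 3 / ?d2 + 3 / ?d3 = 3 * ?k2 / ((k1 u)\<^sup>2 + 9)" .
    have "((\<lambda>u. arctan (k1 u / 3)) has_real_derivative inverse (1 + (k1 u / 3)\<^sup>2) * (?k2 / 3)) (at u)"
      by (intro DERIV_chain2[OF DERIV_arctan] DERIV_cdivide k1_deriv)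
    also have "inverse (1 + (k1 u / 3)\<^sup>2) * (?k2 / 3) = 3 * ?k2 / ((k1 u)\<^sup>2 + 9)"
      using pos by (simp add: divide_simps power2_eq_square) (simp add: algebra_simps)
    finally have "((\<lambda>u. phase r1 u + phase r2 u + phase r3 u - arctan (k1 u / 3)) has_real_derivative
       3 / ?d1 + 3 / ?d2 + 3 / ?d3 - 3 * ?k2 / ((k1 u)\<^sup>2 + 9)) (at u)"
      by (intro DERIV_diff DERIV_add phase_deriv root1 root2 root3)
    then show ?thesis
      by (simp add: sum has_real_derivative_iff_has_vector_derivative)
  qed
  from zero_vector_derivative_imp_eq[OF this, of "0 + period" 0]
  have "2 * pi * (Theta (2 * r1) m l + Theta (2 * r2) m l + Theta (2 * r3) m l) = 0"
    unfolding phase_add_period[OF root1] phase_add_period[OF root2] phase_add_period[OF root3]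
      k1_add_period by (simp add: algebra_simps)
  then show ?thesis
    by (simp add: r1_def)
qed

text \<open>A common denominator makes all three eigenfunctions periodic. Their vectors separate
  points, so the lift itself is periodic, with factor 1.\<close>

lemma closed_if_Theta_rational:
  assumes root2: "charpoly (of_real r2) = 0" and root3: "charpoly (of_real r3) = 0"
    and distinct: "r2 \<noteq> r3" "- r2 - r3 \<noteq> r2" "- r2 - r3 \<noteq> r3"
    and rat: "Theta (2 * r2) m l \<in> \<rat>" "Theta (2 * r3) m l \<in> \<rat>"
  shows "closed_curve G"
proof -
  define r1 where "r1 = - r2 - r3"
  define S where "S = {r1, r2, r3}"
  have root1: "charpoly (of_real r1) = 0"
    using vieta[OF root2 root3 distinct(1)] root2 unfolding charpoly_of_real r1_def by algebra
  have root: "charpoly (of_real j) = 0" if "j \<in> S" for j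
    using that root1 root2 root3 by (auto simp: S_def)
  obtain a2 b2 :: int where 2: "b2 > 0" "Theta (2 * r2) m l = of_int a2 / of_int b2"
    using rat(1) by (metis Rats_cases')
  obtain a3 b3 :: int where 3: "b3 > 0" "Theta (2 * r3) m l = of_int a3 / of_int b3"
    using rat(2) by (metis Rats_cases')
  \<comment> \<open>The product of the two denominators; \<open>Theta_sum\<close> makes it work for
    the third root as well.\<close>
  define n where "n = nat (b2 * b3)"
  have n: "0 < n" "real n = of_int b2 * of_int b3"
    using 2(1) 3(1) by (simp_all add: n_def)
  have n2: "real n * Theta (2 * r2) m l = of_int (a2 * b3)"
    and n3: "real n * Theta (2 * r3) m l = of_int (a3 * b2)"
    using 2 3 by (simp_all add: n)
  have n1: "real n * Theta (2 * r1) m l = of_int (- (a2 * b3) - a3 * b2)"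
  proof -
    have "Theta (2 * r1) m l = - Theta (2 * r2) m l - Theta (2 * r3) m l"
      using Theta_sum[OF root2 root3 distinct(1) root1[unfolded r1_def]] by (simp add: r1_def)
    then have "real n * Theta (2 * r1) m l = - (real n * Theta (2 * r2) m l) - real n * Theta (2 * r3) m l"
      by (simp only: right_diff_distrib mult_minus_right)
    then show ?thesis
      unfolding n2 n3 by simp
  qed
  have int: "real n * Theta (2 * j) m l \<in> \<int>" if "j \<in> S" for j
    using that n1 n2 n3 by (auto simp: S_def)
  have per: "exp (log_eigen j (u + real n * period)) = exp (log_eigen j u)" if j: "j \<in> S" for j u
  proof -
    obtain i :: int where i: "real n * Theta (2 * j) m l = of_int i"
      using int[OF j] by (auto elim: Ints_cases)
    have "exp (\<i> * of_real (2 * pi * of_int i)) = 1"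
      by (auto simp: exp_eq_1)
    then show ?thesis
      unfolding exp_log_eigen_add_periods[OF root[OF j]] i by simp
  qed
  have "\<exists>v. \<forall>u. herm v (G u) = exp (log_eigen j u)
      \<and> herm v (G1 u) = log_deriv (of_real j) u * exp (log_eigen j u)
      \<and> herm v (G2 u) = (of_real j - 4/3 * of_real (k u)) * exp (log_eigen j u)" if "j \<in> S" for j
    using eigenfunction_represented[OF root[OF that] log_eigen_deriv[OF root[OF that]]] by metis
  then obtain v where v:
      "\<And>j u. j \<in> S \<Longrightarrow> herm (v j) (G u) = exp (log_eigen j u)"
      "\<And>j u. j \<in> S \<Longrightarrow> herm (v j) (G1 u) = log_deriv (of_real j) u * exp (log_eigen j u)"
      "\<And>j u. j \<in> S \<Longrightarrow> herm (v j) (G2 u) = (of_real j - 4/3 * of_real (k u)) * exp (log_eigen j u)"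
    by metis
  have "G (u + real n * period) - G u = 0" for u
  proof (rule orthogonal_eigenvectors_imp_zero[OF root])
    show "r1 \<in> S" "r2 \<in> S" "r3 \<in> S" "r1 \<noteq> r2" "r1 \<noteq> r3" "r2 \<noteq> r3"
      using distinct by (auto simp: S_def r1_def)
    fix j assume j: "j \<in> S"
    show "herm (v j) (G u) = exp (log_eigen j u)"
      "herm (v j) (G1 u) = log_deriv (of_real j) u * exp (log_eigen j u)"
      "herm (v j) (G2 u) = (of_real j - 4/3 * of_real (k u)) * exp (log_eigen j u)"
      by (rule v[OF j])+
    show "herm (v j) (G (u + real n * period) - G u) = 0"
      by (simp add: herm_diff_right v(1)[OF j] per[OF j])
  qed simp_all
  then have "G (u + real n * period) = 1 *s G u" for u
    by simp
  moreover have "0 < real n * period"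
    using n(1) period_pos by simp
  ultimately show ?thesis
    unfolding closed_curve_def by (metis one_neq_zero)
qed

section \<open>Discriminant and trigonometric roots\<close>

lemma sigma_pos: "0 < sigma_m m"
proof -
  have "1 - m + m\<^sup>2 = (m - 1/2)\<^sup>2 + 3/4"
    by (simp add: power2_eq_square algebra_simps)
  then show ?thesis
    by (simp add: sigma_m_def add_nonneg_pos)
qed

lemma sigma_squared: "(sigma_m m)\<^sup>2 = 1 - m + m\<^sup>2"
  using sigma_pos by (simp add: sigma_m_def)

text \<open>The cubic in lambda = 2 mu, multiplied by 24 to clear denominators.\<close>

lemma charpoly_half_lambda:
  "charpoly (of_real (x / 2)) = 0 \<longleftrightarrow>
    27 * x^3 - 36 * (sigma_m m)\<^sup>2 * l^4 * x = 8 * ((m - 2) * (1 + m) * (2*m - 1) * l^6 - 27)"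
  unfolding charpoly_of_real C1_def C2_def sigma_squared
  by (auto simp: field_simps power3_eq_cube)

text \<open>Shows that positivity of \<open>pp\<close> means |\<open>pt\<close>| < 1, the condition
  for the trigonometric solution of the cubic.\<close>

lemma pp_eq:
  "27 * pp m l = 64 * (4 * (sigma_m m ^ 3 * l^6)\<^sup>2 - ((m - 2) * (1 + m) * (2*m - 1) * l^6 - 27)\<^sup>2)"
proof -
  have l12: "l^12 = (l^6)\<^sup>2"
    by (simp flip: power_mult)
  have "(sigma_m m ^ 3 * l^6)\<^sup>2 = ((sigma_m m)\<^sup>2)^3 * (l^6)\<^sup>2"
    by (simp add: power_mult_distrib flip: power_mult)
  then show ?thesis
    unfolding sigma_squared pp_def l12 by algebra
qed

text \<open>Splitting off a real root r leaves a quadratic with discriminant (4 C1 - 9 r^2)/3. If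
  this is zero there is a double root, if negative a nonreal one; closedness excludes both.\<close>

lemma closed_imp_pp_pos:
  assumes closed: "closed_curve G"
  shows "0 < pp m l"
proof (rule ccontr)
  assume neg: "\<not> 0 < pp m l"
  obtain r where r: "9 * r^3 - 3 * C1 * r + 2 * C2 + 9 = 0"
  proof -
    define F where "F r = 9 * r^3 - 3 * C1 * r + 2 * C2 + 9" for r :: real
    have "isCont F r" for r
      unfolding F_def by (intro continuous_intros)
    \<comment> \<open>A crude bound at which the leading term dominates, so that \<open>F\<close>
      changes sign between \<open>- B\<close> and \<open>B\<close>.\<close>
    moreover define B where "B = 1 + \<bar>C1\<bar> + \<bar>2 * C2 + 9\<bar>"
    have B: "1 \<le> B" "\<bar>C1\<bar> \<le> B" "\<bar>2 * C2 + 9\<bar> \<le> B" by (auto simp: B_def)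
    have "B\<^sup>2 \<le> B^3" "B \<le> B\<^sup>2"
      using B(1) by (auto intro: power_increasing self_le_power)
    moreover have "\<bar>C1 * B\<bar> \<le> B\<^sup>2"
      using B by (simp add: abs_mult power2_eq_square mult_right_mono)
    ultimately have "F (- B) \<le> 0" "0 \<le> F B"
      using B unfolding F_def by (auto simp: abs_le_iff)
    with \<open>\<And>r. isCont F r\<close> obtain r where "F r = 0"
      using IVT[of F "- B" 0 B] B(1) by auto
    then show ?thesis using that by (simp add: F_def)
  qed
  have root: "charpoly (of_real r) = 0"
    using r by (simp add: charpoly_of_real)
  have simple: "9 * r\<^sup>2 - C1 \<noteq> 0"
    using closed_imp_root_simple[OF closed root] by simp
  have C1: "4 * (sigma_m m ^ 3 * l^6)\<^sup>2 = 4 * C1^3"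
    unfolding C1_def sigma_squared[symmetric] by (simp add: power_mult_distrib flip: power_mult)
  have C2: "(m - 2) * (1 + m) * (2*m - 1) * l^6 - 27 = - 3 * (2 * C2 + 9)"
    by (simp add: C2_def)
  \<comment> \<open>The discriminant of the cubic factored through the known root; the squared
    factor is nonzero because the root is simple.\<close>
  have "27 * pp m l = 64 * ((4 * C1 - 9 * r\<^sup>2) * (9 * r\<^sup>2 - C1)\<^sup>2)"
    unfolding pp_eq C1 C2 using r by algebra
  with neg simple have "4 * C1 - 9 * r\<^sup>2 \<le> 0"
    by (smt (verit) mult_pos_pos zero_less_power2)
  then consider "9 * r\<^sup>2 = 4 * C1" | "4 * C1 < 9 * r\<^sup>2"
    by linarith
  then show False
  proof cases
    case 1
    \<comment> \<open>The remaining quadratic has \<open>- r / 2\<close> as its double zero.\<close>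
    have "charpoly (of_real (- r / 2)) = 0"
      unfolding charpoly_of_real using r 1 by (simp add: power3_eq_cube field_simps) algebra
    from closed_imp_root_simple[OF closed this] show False
      using 1 by (simp add: power2_eq_square)
  next
    case 2
    \<comment> \<open>The imaginary part of the nonreal pair of roots, whose real part is
      \<open>- r / 2\<close>.\<close>
    define y where "y = sqrt ((9 * r\<^sup>2 - 4 * C1) / 12)"
    have y: "y\<^sup>2 = (9 * r\<^sup>2 - 4 * C1) / 12" "y \<noteq> 0"
      using 2 by (auto simp: y_def)
    then have C1: "C1 = (9 * r\<^sup>2 - 12 * y\<^sup>2) / 4"
      by simp
    have C2: "2 * C2 + 9 = 3 * C1 * r - 9 * r^3"
      using r by simp
    define \<mu> where "\<mu> = Complex (- r / 2) y"
    have "charpoly \<mu> = 9 * \<mu>^3 - 3 * of_real C1 * \<mu> + of_real (2 * C2 + 9)"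
      by (simp add: charpoly_def)
    also have "\<dots> = 0"
      unfolding C2 C1 \<mu>_def
      by (simp add: complex_eq_iff power2_eq_square power3_eq_cube) (simp add: field_simps)
    finally show False
      using closed_imp_root_real[OF closed, of \<mu>] y(2) by (simp add: \<mu>_def)
  qed
qed

text \<open>The trigonometric solution of the cubic: the triple-angle formula turns sin(3 alpha) =
  \<open>pt\<close> into the root equation.\<close>

lemma lambda_roots:
  assumes pp: "0 < pp m l"
  shows "charpoly (of_real (lambda2 m l / 2)) = 0" "charpoly (of_real (lambda3 m l / 2)) = 0"
    and "lambda2 m l \<noteq> lambda3 m l" "- lambda2 m l - lambda3 m l \<noteq> lambda2 m l"
      "- lambda2 m l - lambda3 m l \<noteq> lambda3 m l"
proof -
  define X where "X = (m - 2) * (1 + m) * (2*m - 1) * l^6 - 27"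
  define Z where "Z = sigma_m m * l\<^sup>2"
  define s c t where "s = sin (alpha_ml m l)" and "c = cos (alpha_ml m l)" and "t = sqrt 3"
  have Z: "0 < Z"
    using sigma_pos l_pos by (simp add: Z_def)
  have Z3: "sigma_m m ^ 3 * l^6 = Z^3" and Z2: "(sigma_m m)\<^sup>2 * l^4 = Z\<^sup>2"
    by (simp_all add: Z_def power_mult_distrib flip: power_mult)
  have t: "t\<^sup>2 = 3" "0 < t" by (simp_all add: t_def)
  have "X\<^sup>2 < (2 * Z^3)\<^sup>2"
    using pp pp_eq unfolding X_def[symmetric] Z3 by (simp add: power_mult_distrib)
  then have "\<bar>X\<bar> < 2 * Z^3"
    using Z by (intro power2_less_imp_less[of "\<bar>X\<bar>"]) auto
  moreover have pt: "pt m l = X / (2 * Z^3)"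
    by (simp add: pt_def X_def Z3 mult.assoc)
  ultimately have pt_bounds: "- 1 < pt m l" "pt m l < 1"
    using Z by (simp_all add: pos_less_divide_eq pos_divide_less_eq abs_less_iff)
  then have "sin (3 * alpha_ml m l) = pt m l"
    by (simp add: alpha_ml_def)
  then have X: "X = 2 * Z^3 * (3 * s - 4 * s^3)"
    using Z unfolding sin_triple s_def[symmetric] pt by (simp add: field_simps)
  have alpha: "- (pi/6) < alpha_ml m l" "alpha_ml m l < pi/6"
    using arcsin_lt_bounded[OF pt_bounds] by (auto simp: alpha_ml_def)
  \<comment> \<open>Strict bounds on the angle give |s| < 1/2 and sqrt 3 cos alpha > 3/2, which keep
    the three roots apart.\<close>
  then have "s < sin (pi/6)" "sin (- (pi/6)) < s"
    unfolding s_def using pi_gt_zero by (auto intro!: sin_monotone_2pi simp del: sin_minus)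
  then have s: "s < 1/2" "- 1/2 < s"
    by (simp_all add: sin_30)
  have c_pos: "0 < c"
    unfolding c_def using alpha pi_gt_zero by (intro cos_gt_zero_pi) auto
  have c: "c\<^sup>2 = 1 - s\<^sup>2"
    by (simp add: c_def s_def cos_squared)
  have "0 < (1/2 - s) * (1/2 + s)"
    using s by (intro mult_pos_pos) auto
  then have "(3/2)\<^sup>2 < (t * c)\<^sup>2"
    by (simp add: power_mult_distrib t c) (simp add: power2_eq_square algebra_simps)
  then have tc: "3/2 < t * c"
    using t c_pos by (intro power2_less_imp_less[of "3/2" "t * c"]) auto
  have l2: "lambda2 m l = - 4/3 * Z * s"
    by (simp add: lambda2_def Z_def s_def)
  have "2 / t = 2/3 * t"
    using t by (simp add: field_simps power2_eq_square)
  then have l3: "lambda3 m l = 2/3 * Z * (s + t * c)"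
    unfolding lambda3_def s_def[symmetric] c_def[symmetric] t_def[symmetric]
    by (simp only:) (simp add: Z_def algebra_simps)
  show "charpoly (of_real (lambda2 m l / 2)) = 0"
    unfolding charpoly_half_lambda X_def[symmetric] mult.assoc[of 36] Z2 l2 X
    by (simp add: field_simps power2_eq_square power3_eq_cube)
  show "charpoly (of_real (lambda3 m l / 2)) = 0"
  proof -
    \<comment> \<open>The second root is the first with a shifted angle; the cube is reduced using
      t^2 = 3 and c^2 = 1 - s^2.\<close>
    have "(s + t * c)^3 - 3 * (s + t * c) = s^3 + 3 * s\<^sup>2 * (t * c) + 3 * s * (t\<^sup>2 * c\<^sup>2)
        + t * c * (t\<^sup>2 * c\<^sup>2) - 3 * s - 3 * (t * c)"
      by (simp add: power2_eq_square power3_eq_cube algebra_simps)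
    also have "\<dots> = 6 * s - 8 * s^3"
      unfolding t(1) c by (simp add: power2_eq_square power3_eq_cube algebra_simps)
    finally have "(s + t * c)^3 - 3 * (s + t * c) = 6 * s - 8 * s^3" .
    moreover have "27 * (2/3 * Z * y)^3 - 36 * (Z\<^sup>2 * (2/3 * Z * y)) = 8 * Z^3 * (y^3 - 3 * y)" for y
      by (simp add: field_simps power2_eq_square power3_eq_cube)
    ultimately have "27 * (2/3 * Z * (s + t * c))^3 - 36 * (Z\<^sup>2 * (2/3 * Z * (s + t * c)))
        = 8 * (2 * Z^3 * (3 * s - 4 * s^3))"
      by (simp only:) (simp add: algebra_simps)
    then show ?thesis
      unfolding charpoly_half_lambda X_def[symmetric] mult.assoc[of 36] Z2 l3 X .
  qed
  have "lambda3 m l - lambda2 m l = Z * (2 * s + 2/3 * (t * c))"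
    "- lambda2 m l - lambda3 m l - lambda2 m l = Z * (2 * s - 2/3 * (t * c))"
    "- lambda2 m l - lambda3 m l - lambda3 m l = Z * (- 4/3 * (t * c))"
    unfolding l2 l3 by (simp_all add: field_simps)
  moreover have "2 * s + 2/3 * (t * c) \<noteq> 0" "2 * s - 2/3 * (t * c) \<noteq> 0" "- 4/3 * (t * c) \<noteq> 0"
    using s tc by linarith+
  ultimately show "lambda2 m l \<noteq> lambda3 m l" "- lambda2 m l - lambda3 m l \<noteq> lambda2 m l"
      "- lambda2 m l - lambda3 m l \<noteq> lambda3 m l"
    using Z by (metis eq_iff_diff_eq_0 less_irrefl mult_eq_0_iff)+
qed

theorem closed_iff:
  "closed_curve G \<longleftrightarrow>
     pp m l > 0 \<and> Theta (lambda2 m l) m l \<in> \<rat> \<and> Theta (lambda3 m l) m l \<in> \<rat>"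
proof
  assume closed: "closed_curve G"
  then have pp: "pp m l > 0"
    by (rule closed_imp_pp_pos)
  then show "pp m l > 0 \<and> Theta (lambda2 m l) m l \<in> \<rat> \<and> Theta (lambda3 m l) m l \<in> \<rat>"
    using closed_imp_Theta_rational[OF closed lambda_roots(1)]
      closed_imp_Theta_rational[OF closed lambda_roots(2)] by simp
next
  assume *: "pp m l > 0 \<and> Theta (lambda2 m l) m l \<in> \<rat> \<and> Theta (lambda3 m l) m l \<in> \<rat>"
  then have pp: "pp m l > 0" by simp
  show "closed_curve G"
    by (rule closed_if_Theta_rational[OF lambda_roots(1,2)[OF pp]])
       (use * lambda_roots(3-5)[OF pp] in auto)
qed

end

theorem mainTheorem7:
  fixes G :: "real \<Rightarrow> complex^3" and m l :: real
  assumes "is_string_lift G"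
    and "0 < m" and "m < 1" and "0 < l"
    and "\<exists>u0. \<forall>u. inv_b G u = kappa_ml m l (u + u0)"
  shows "closed_curve G \<longleftrightarrow>
           (pp m l > 0 \<and> Theta (lambda2 m l) m l \<in> \<rat> \<and> Theta (lambda3 m l) m l \<in> \<rat>)"
proof -
  obtain u0 where u0: "\<And>u. inv_b G u = kappa_ml m l (u + u0)"
    using assms(5) by blast
  interpret string_lift G m l u0
    by unfold_locales (use assms u0 in \<open>auto simp: is_string_lift_def\<close>)
  show ?thesis
    by (rule closed_iff)
qed

end
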